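(* Take any $\delta\in(0,\alpha)$ and integer $p\ge1$. For $t>0$ and $k\in[\delta t,\alpha t]$, there is a constant $C_p$ depending only on $p$ such that $$\mathbb{E}\left(\sup_{x\in[k,k+1]}|u(x,t)-u(k,t)|^{2p}\right)\le C_pk^{-p/2},\qquad \mathbb{E}\left(\sup_{x\in[k,k+1]}|\partial_xu(x,t)-\partial_xu(k,t)|^{2p}\right)\le C_pk^{-3p/2}.$$ Consequently, for any $\eta>0$ and $\mu>0$, with probability one, there is a positive integer $N$ such that for all integers $n\ge N$, $$\sup_{x\in[k,k+1]}|u(x,n)-u(k,n)|\le\mu k^{-(\frac14-\eta)},\qquad \sup_{x\in[k,k+1]}|\partial_xu(x,n)-\partial_xu(k,n)|\le\mu k^{-(\frac34-\eta)}$$ for all $k\in[\delta n,\alpha n]\cap\mathbb{Z}$.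
   Context: Fix, once and for all, $\alpha\in(0,1)$ (constants may depend on it) and let $\sigma=\sqrt{\alpha(1-\alpha)}$. Let $W$ be a standard two-dimensional Brownian motion on $[0,\infty)$. The continuous two-dimensional Conga line is, for $x>0$, $t>0$, $$u(x,t)=\int_0^t W(t-z)\,\frac{1}{\sqrt{2\pi}}\,\frac{x+\alpha z}{2\sigma z^{3/2}}\exp\left(-\frac{(x-\alpha z)^2}{2\sigma^2 z}\right)dz .$$ $\partial_xu$ is its partial derivative in $x$; $|\cdot|$ is the Euclidean norm. *)

theory Defs
  imports "HOL-Probability.Probability"
begin

locale std_planar_brownian_motion = prob_space M
  for M :: "'a measure" +
  fixes W :: "real \<Rightarrow> 'a \<Rightarrow> real ^ 2"
  assumes random_variable_W: "0 \<le> t \<Longrightarrow> random_variable borel (W t)"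
    and W_0: "\<omega> \<in> space M \<Longrightarrow> W 0 \<omega> = 0"
    and continuous_paths: "\<omega> \<in> space M \<Longrightarrow> continuous_on {0..} (\<lambda>t. W t \<omega>)"
    and indep_increments:
      "\<And>(r :: nat \<Rightarrow> real) n. 0 \<le> r 0 \<Longrightarrow> mono r \<Longrightarrow>
         indep_vars (\<lambda>_. borel) (\<lambda>i \<omega>. W (r (Suc i)) \<omega> - W (r i) \<omega>) {..<n}"
    \<comment> \<open>the increments are centred Gaussian with covariance matrix \<open>(t - s) I\<close>\<close>
    and indep_coordinates:
      "0 \<le> s \<Longrightarrow> s < t \<Longrightarrow>
         indep_vars (\<lambda>_. borel) (\<lambda>j \<omega>. (W t \<omega> - W s \<omega>) $ j) (UNIV :: 2 set)"
    and normal_coordinates: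
      "0 \<le> s \<Longrightarrow> s < t \<Longrightarrow>
         distributed M lborel (\<lambda>\<omega>. (W t \<omega> - W s \<omega>) $ j) (normal_density 0 (sqrt (t - s)))"

definition conga_sigma :: "real \<Rightarrow> real" where
  "conga_sigma \<alpha> = sqrt (\<alpha> * (1 - \<alpha>))"

definition conga_kernel :: "real \<Rightarrow> real \<Rightarrow> real \<Rightarrow> real" where
  "conga_kernel \<alpha> x z =
     1 / sqrt (2 * pi) * ((x + \<alpha> * z) / (2 * conga_sigma \<alpha> * z powr (3/2)))
       * exp (- ((x - \<alpha> * z)\<^sup>2 / (2 * (conga_sigma \<alpha>)\<^sup>2 * z)))"

text \<open>The Conga line is defined pathwise: \<open>w\<close> is one path of the Brownian motion.\<close>

definition conga :: "real \<Rightarrow> (real \<Rightarrow> real ^ 2) \<Rightarrow> real \<Rightarrow> real \<Rightarrow> real ^ 2" where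
  "conga \<alpha> w x t = (LBINT z:{0<..<t}. conga_kernel \<alpha> x z *\<^sub>R w (t - z))"

definition conga_dx :: "real \<Rightarrow> (real \<Rightarrow> real ^ 2) \<Rightarrow> real \<Rightarrow> real \<Rightarrow> real ^ 2" where
  "conga_dx \<alpha> w x t = vector_derivative (\<lambda>y. conga \<alpha> w y t) (at x)"

text \<open>Suprema and expectations are taken in \<open>ennreal\<close>, so that neither can take a default value.
  Because \<open>nn_integral\<close> is only a lower integral on non-measurable functions, a bound on the
  expectation of \<open>X\<close> includes that \<open>X\<close> is a random variable.\<close>

definition expectation_le :: "'a measure \<Rightarrow> ('a \<Rightarrow> ennreal) \<Rightarrow> real \<Rightarrow> bool" where
  "expectation_le M X c \<longleftrightarrow> X \<in> borel_measurable M \<and> (\<integral>\<^sup>+ \<omega>. X \<omega> \<partial>M) \<le> ennreal c"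

end

theory Submission
  imports Defs "HOL-Real_Asymp.Real_Asymp"
begin

text \<open>
  The kernel of the Conga line is a \<open>z\<close>-derivative: with \<open>\<Phi>\<close> the standard normal distribution function,
  it equals \<open>\<partial>\<^sub>z F(x, z)\<close> for the mass \<open>F(x, z) = \<Phi> ((\<alpha> z - x) / (\<sigma> sqrt z))\<close>. Differentiating the
  Conga line in \<open>x\<close> once or twice under the integral therefore gives
  \<open>\<integral>\<^sub>0\<^sup>t \<partial>\<^sub>z G(x, z) W(t - z) dz\<close> with \<open>G = \<partial>\<^sub>x F\<close> or \<open>G = \<partial>\<^sub>x\<^sup>2 F\<close>, and a summation by parts turns this into
  the Wiener integral of \<open>G(x, t - s)\<close> against \<open>dW(s)\<close>: the boundary terms vanish because \<open>W(0) = 0\<close> and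
  \<open>G(x, 0) = 0\<close>. It is a centred Gaussian vector with variance \<open>\<integral>\<^sub>0\<^sup>t G(x, z)\<^sup>2 dz\<close> in each coordinate, so
  its moment of order \<open>2 p\<close> is at most a constant times the \<open>p\<close>-th power of that integral
  (\<open>reversed_path_integral_moment_le\<close>).

  For large \<open>x\<close> both squares \<open>G\<^sup>2\<close> are concentrated on \<open>z\<close> within order \<open>sqrt x\<close> of \<open>x / \<alpha>\<close>.
  Integrating them gives, for every \<open>x > 0\<close>, a bound of order \<open>x\<^sup>-\<^sup>1\<^sup>/\<^sup>2\<close> for \<open>\<partial>\<^sub>x F\<close> and of order
  \<open>(1/x + 1/x\<^sup>2) x\<^sup>-\<^sup>1\<^sup>/\<^sup>2\<close> for \<open>\<partial>\<^sub>x\<^sup>2 F\<close> (\<open>mass_dx_square_integral\<close>, \<open>mass_dxx_square_integral\<close>). The bounds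
  do not depend on \<open>t\<close>, which is why the constant of the theorem is independent of \<open>\<delta>\<close> and \<open>t\<close>.

  The supremum over \<open>x \<in> [k, k + 1]\<close> is removed by the fundamental theorem of calculus: an increment of a
  differentiable function is at most the integral of the norm of its derivative, and the power mean
  inequality, with a weight \<open>h\<close> that dominates the size of the derivative, passes to moments
  (\<open>expectation_sup_increment_le\<close>). For the Conga line itself a constant weight is enough. For its
  derivative, the bound on the size of the second derivative grows like \<open>x\<^sup>-\<^sup>5\<^sup>/\<^sup>4\<close> near \<open>x = 0\<close>, and \<open>k\<close> may be arbitrarily
  small; the weight \<open>k\<^sup>-\<^sup>3\<^sup>/\<^sup>4 (1 + y\<^sup>-\<^sup>1\<^sup>/\<^sup>2)\<close> has integral of order \<open>k\<^sup>-\<^sup>3\<^sup>/\<^sup>4\<close> for all \<open>k > 0\<close>.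

  The almost sure bounds follow from Markov's inequality and the Borel-Cantelli lemma
  (\<open>AE_eventually_sup_le\<close>): for \<open>2 p \<eta> \<ge> 3\<close> the at most \<open>n\<close> exceptional events with parameter \<open>n\<close> have
  total probability of order \<open>n\<^sup>-\<^sup>2\<close>.

  All limits of integrals are handled by Riemann-Stieltjes sums and Fatou's lemma. This gives the
  measurability of the integrals over paths, replaces the \<open>L\<^sup>2\<close> theory of the Wiener integral, and avoids
  joint measurability in \<open>(x, \<omega>)\<close> when an expectation is taken of an integral over \<open>x\<close>.
\<close>

section \<open>Riemann-Stieltjes sums on uniform grids\<close>

definition grid :: "real \<Rightarrow> real \<Rightarrow> nat \<Rightarrow> nat \<Rightarrow> real" where
  "grid a b n i = a + (b - a) * real i / real n"

lemma grid_0 [simp]: "grid a b n 0 = a"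
  by (simp add: grid_def)

lemma grid_end [simp]: "n > 0 \<Longrightarrow> grid a b n n = b"
  by (simp add: grid_def)

lemma grid_step: "grid a b n (Suc i) - grid a b n i = (b - a) / real n"
  by (simp add: grid_def add_divide_distrib[symmetric] diff_divide_distrib[symmetric]) (simp add: algebra_simps)

lemma grid_mono: "a \<le> b \<Longrightarrow> i \<le> j \<Longrightarrow> grid a b n i \<le> grid a b n j"
  by (simp add: grid_def divide_right_mono mult_left_mono)

lemma grid_in: "a \<le> b \<Longrightarrow> n > 0 \<Longrightarrow> i \<le> n \<Longrightarrow> grid a b n i \<in> {a..b}"
  using grid_mono[of a b 0 i n] grid_mono[of a b i n n] by simp

lemma integral_sum_grid:
  fixes f :: "real \<Rightarrow> 'b::banach"
  assumes "a \<le> b" "n > 0" "f integrable_on {a..b}"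
  shows "integral {a..b} f = (\<Sum>i<n. integral {grid a b n i..grid a b n (Suc i)} f)"
proof -
  have "integral {a..grid a b n m} f = (\<Sum>i<m. integral {grid a b n i..grid a b n (Suc i)} f)" if "m \<le> n" for m
    using that
  proof (induction m)
    case (Suc m)
    have "integral {a..grid a b n m} f + integral {grid a b n m..grid a b n (Suc m)} f
          = integral {a..grid a b n (Suc m)} f"
    proof (rule Henstock_Kurzweil_Integration.integral_combine)
      show "f integrable_on {a..grid a b n (Suc m)}"
        using grid_in[OF assms(1,2) Suc.prems] assms(3)
        by (auto intro: integrable_subinterval_real)
    qed (use grid_in[OF assms(1,2), of m] Suc.prems grid_mono[OF assms(1), of m "Suc m" n] in auto)
    with Suc show ?case by simp
  qed simp
  from this[of n] assms show ?thesis by simp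
qed

text \<open>The weights are exact integrals of \<open>h\<close>, so only the oscillation of \<open>f\<close> over one cell contributes to the
  error. Tags are arbitrary because left and right tags both occur after a summation by parts.\<close>

lemma stieltjes_sums_tendsto:
  fixes f :: "real \<Rightarrow> 'b::euclidean_space" and h :: "real \<Rightarrow> real"
  assumes ab: "a \<le> b" and f: "continuous_on {a..b} f" and h: "continuous_on {a..b} h"
    and c: "\<And>n i. i < n \<Longrightarrow> c n i \<in> {grid a b n i..grid a b n (Suc i)}"
  shows "(\<lambda>n. \<Sum>i<n. integral {grid a b n i..grid a b n (Suc i)} h *\<^sub>R f (c n i))
           \<longlonglongrightarrow> integral {a..b} (\<lambda>z. h z *\<^sub>R f z)"
proof (rule LIMSEQ_I)
  fix e :: real assume e: "e > 0"
  have "bounded (h ` {a..b})"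
    using h by (intro compact_imp_bounded compact_continuous_image) auto
  then obtain B where B: "B > 0" "\<And>z. z \<in> {a..b} \<Longrightarrow> \<bar>h z\<bar> \<le> B"
    unfolding bounded_pos by (auto simp: real_norm_def)
  define e' where "e' = e / (2 * B * (b - a + 1))"
  have e': "e' > 0" using e B ab by (simp add: e'_def)
  have "uniformly_continuous_on {a..b} f"
    using f by (intro compact_uniformly_continuous) auto
  then obtain d where d: "d > 0" "\<And>y z. y \<in> {a..b} \<Longrightarrow> z \<in> {a..b} \<Longrightarrow> dist z y < d \<Longrightarrow> dist (f z) (f y) < e'"
    unfolding uniformly_continuous_on_def using e' by metis
  obtain N where N: "(b - a) / d < real N" using reals_Archimedean2 by blast
  show "\<exists>N. \<forall>n\<ge>N. norm ((\<Sum>i<n. integral {grid a b n i..grid a b n (Suc i)} h *\<^sub>R f (c n i))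
            - integral {a..b} (\<lambda>z. h z *\<^sub>R f z)) < e"
  proof (intro exI[of _ "Suc N"] allI impI)
    fix n assume n: "n \<ge> Suc N"
    then have n0: "n > 0" by simp
    have mesh: "(b - a) / real n < d"
    proof -
      have "(b - a) / d < real n" using N n by simp
      then show ?thesis using d n0 by (simp add: field_simps)
    qed
    have hf: "(\<lambda>z. h z *\<^sub>R f z) integrable_on {a..b}"
      by (intro integrable_continuous_real continuous_intros f h)
    let ?I = "\<lambda>i. {grid a b n i..grid a b n (Suc i)}"
    have piece: "norm (integral (?I i) h *\<^sub>R f (c n i) - integral (?I i) (\<lambda>z. h z *\<^sub>R f z))
                   \<le> B * e' * ((b - a) / real n)" if i: "i < n" for i
    proof -
      have sub: "?I i \<subseteq> {a..b}"
        using grid_in[OF ab n0, of i] grid_in[OF ab n0, of "Suc i"] i by auto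
      have hi: "continuous_on (?I i) h" and fi: "continuous_on (?I i) f"
        using h f sub by (auto intro: continuous_on_subset)
      have "integral (?I i) h *\<^sub>R f (c n i) - integral (?I i) (\<lambda>z. h z *\<^sub>R f z)
            = integral (?I i) (\<lambda>z. h z *\<^sub>R f (c n i)) - integral (?I i) (\<lambda>z. h z *\<^sub>R f z)"
        using integrable_continuous_real[OF hi] by (simp add: integral_unique[OF has_integral_scaleR_left[OF integrable_integral]])
      also have "\<dots> = integral (?I i) (\<lambda>z. h z *\<^sub>R f (c n i) - h z *\<^sub>R f z)"
        by (rule Henstock_Kurzweil_Integration.integral_diff[symmetric]; intro integrable_continuous_real continuous_intros hi fi)
      also have "\<dots> = integral (?I i) (\<lambda>z. h z *\<^sub>R (f (c n i) - f z))"
        by (simp add: scaleR_diff_right)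
      also have "norm \<dots> \<le> (B * e') * (grid a b n (Suc i) - grid a b n i)"
      proof (rule integral_bound)
        fix z assume z: "z \<in> ?I i"
        have "dist (c n i) z \<le> (b - a) / real n"
          using c[OF i] z grid_step[of a b n i] by (auto simp: dist_real_def)
        then have "dist (f (c n i)) (f z) < e'"
          using mesh sub z c[OF i] by (intro d(2)) auto
        then show "norm (h z *\<^sub>R (f (c n i) - f z)) \<le> B * e'"
          using B(2)[of z] sub z B(1) e' by (auto simp: dist_norm intro!: mult_mono)
      qed (use grid_mono[OF ab, of i "Suc i" n] in \<open>auto intro!: continuous_intros hi fi\<close>)
      finally show ?thesis by (simp add: grid_step)
    qed
    have "(\<Sum>i<n. integral (?I i) h *\<^sub>R f (c n i)) - integral {a..b} (\<lambda>z. h z *\<^sub>R f z)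
        = (\<Sum>i<n. integral (?I i) h *\<^sub>R f (c n i) - integral (?I i) (\<lambda>z. h z *\<^sub>R f z))"
      using integral_sum_grid[OF ab n0 hf] by (simp add: sum_subtractf)
    also have "norm \<dots> \<le> (\<Sum>i<n. B * e' * ((b - a) / real n))"
      by (rule order_trans[OF norm_sum]) (intro sum_mono piece, simp)
    also have "\<dots> = B * e' * (b - a)" using n0 by simp
    also have "\<dots> < e"
    proof -
      have "B * e' * (b - a) = e * ((b - a) / (2 * (b - a + 1)))"
        using B(1) ab by (simp add: e'_def)
      also have "\<dots> < e * 1"
        using e ab by (intro mult_strict_left_mono) (auto simp: field_simps)
      finally show ?thesis by simp
    qed
    finally show "norm ((\<Sum>i<n. integral (?I i) h *\<^sub>R f (c n i)) - integral {a..b} (\<lambda>z. h z *\<^sub>R f z)) < e" .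
  qed
qed

lemma abel_summation:
  fixes f :: "nat \<Rightarrow> 'b::real_vector" and g :: "nat \<Rightarrow> real"
  shows "(\<Sum>i<n. (g (Suc i) - g i) *\<^sub>R f i)
    = (\<Sum>i<n. g (Suc i) *\<^sub>R (f i - f (Suc i))) + g n *\<^sub>R f n - g 0 *\<^sub>R f 0"
  by (induction n) (auto simp: algebra_simps)

section \<open>Power means, suprema and limits of expectations\<close>

lemma weighted_power_mean:
  fixes w y :: "nat \<Rightarrow> real"
  assumes w: "\<And>i. i < n \<Longrightarrow> 0 \<le> w i" and p: "p \<ge> 1"
  shows "(\<Sum>i<n. w i * y i) ^ (2 * p) \<le> (\<Sum>i<n. w i) ^ (2 * p - 1) * (\<Sum>i<n. w i * y i ^ (2 * p))"
proof (cases "(\<Sum>i<n. w i) = 0")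
  case True
  then have "w i = 0" if "i < n" for i
    using w that by (subst (asm) sum_nonneg_eq_0_iff) auto
  then show ?thesis using p by (simp add: power_0_left)
next
  case False
  define S where "S = (\<Sum>i<n. w i)"
  have S: "S > 0" using False w unfolding S_def by (metis lessThan_iff less_eq_real_def sum_nonneg)
  have n: "{..<n} \<noteq> {}" using False by force
  have "(\<lambda>x. x ^ (2 * p)) (\<Sum>i<n. (w i / S) *\<^sub>R y i) \<le> (\<Sum>i<n. (w i / S) * y i ^ (2 * p))"
    by (rule convex_on_sum[OF _ _ convex_power_even]) (use n S w in \<open>auto simp: S_def sum_divide_distrib[symmetric]\<close>)
  then have "((\<Sum>i<n. w i * y i) / S) ^ (2 * p) \<le> (\<Sum>i<n. w i * y i ^ (2 * p)) / S"
    by (simp add: sum_divide_distrib)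
  then have "(\<Sum>i<n. w i * y i) ^ (2 * p) \<le> S ^ (2 * p) * ((\<Sum>i<n. w i * y i ^ (2 * p)) / S)"
    using S by (simp add: power_divide field_simps)
  also have "\<dots> = S ^ (2 * p - 1) * (\<Sum>i<n. w i * y i ^ (2 * p))"
    using S p by (simp add: power_eq_if)
  finally show ?thesis by (simp add: S_def)
qed

text \<open>By continuity the supremum may be taken over a countable dense subset.\<close>

lemma sup_continuous_measurable:
  fixes f :: "real \<Rightarrow> 'c \<Rightarrow> real"
  assumes cont: "\<And>\<omega>. \<omega> \<in> space M \<Longrightarrow> continuous_on S (\<lambda>x. f x \<omega>)"
    and meas: "\<And>x. x \<in> S \<Longrightarrow> f x \<in> borel_measurable M"
  shows "(\<lambda>\<omega>. SUP x\<in>S. ennreal (f x \<omega>)) \<in> borel_measurable M"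
proof -
  obtain T where T: "countable T" "T \<subseteq> S" "S \<subseteq> closure T"
    using separable .
  have eq: "(SUP x\<in>S. ennreal (f x \<omega>)) = (SUP x\<in>T. ennreal (f x \<omega>))" if \<omega>: "\<omega> \<in> space M" for \<omega>
  proof (rule antisym)
    show "(SUP x\<in>S. ennreal (f x \<omega>)) \<le> (SUP x\<in>T. ennreal (f x \<omega>))"
    proof (rule SUP_least)
      fix x assume x: "x \<in> S"
      then obtain s where s: "\<And>n. s n \<in> T" "s \<longlonglongrightarrow> x"
        using T(3) by (metis closure_sequential subsetD)
      have "(\<lambda>n. f (s n) \<omega>) \<longlonglongrightarrow> f x \<omega>"
        using s T(2) x by (intro continuous_on_tendsto_compose[OF cont[OF \<omega>]] always_eventually) auto
      then have "(\<lambda>n. ennreal (f (s n) \<omega>)) \<longlonglongrightarrow> ennreal (f x \<omega>)"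
        by (rule tendsto_ennrealI)
      then show "ennreal (f x \<omega>) \<le> (SUP x\<in>T. ennreal (f x \<omega>))"
        by (rule LIMSEQ_le_const2) (use s in \<open>auto intro!: SUP_upper\<close>)
    qed
  qed (use T in \<open>auto intro: SUP_subset_mono\<close>)
  have "(\<lambda>\<omega>. SUP x\<in>T. ennreal (f x \<omega>)) \<in> borel_measurable M"
    using T meas by (intro borel_measurable_SUP measurable_compose[OF _ measurable_ennreal]) auto
  then show ?thesis
    by (subst measurable_cong[OF eq]) auto
qed

text \<open>Fatou's lemma in the form in which a moment bound passes from approximating sums to their limit.\<close>

lemma nn_integral_tendsto_le:
  fixes X :: "nat \<Rightarrow> 'c \<Rightarrow> real"
  assumes meas: "\<And>n. X n \<in> borel_measurable M"
    and lim: "\<And>\<omega>. \<omega> \<in> space M \<Longrightarrow> (\<lambda>n. X n \<omega>) \<longlonglongrightarrow> Y \<omega>"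
    and le: "\<And>n. n > 0 \<Longrightarrow> (\<integral>\<^sup>+\<omega>. ennreal (X n \<omega>) \<partial>M) \<le> ennreal (c n)"
    and c: "c \<longlonglongrightarrow> d"
  shows "(\<integral>\<^sup>+\<omega>. ennreal (Y \<omega>) \<partial>M) \<le> ennreal d"
proof -
  have "(\<integral>\<^sup>+\<omega>. ennreal (Y \<omega>) \<partial>M) = (\<integral>\<^sup>+\<omega>. liminf (\<lambda>n. ennreal (X n \<omega>)) \<partial>M)"
    by (intro nn_integral_cong lim_imp_Liminf[symmetric] tendsto_ennrealI lim) auto
  also have "\<dots> \<le> liminf (\<lambda>n. \<integral>\<^sup>+\<omega>. ennreal (X n \<omega>) \<partial>M)"
    by (intro nn_integral_liminf measurable_compose[OF meas measurable_ennreal])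
  also have "\<dots> \<le> liminf (\<lambda>n. ennreal (c n))"
    by (intro Liminf_mono eventually_mono[OF eventually_gt_at_top[of 0]] le)
  also have "\<dots> = ennreal d"
    by (intro lim_imp_Liminf tendsto_ennrealI c) auto
  finally show ?thesis .
qed

section \<open>Even moments of Wiener integrals\<close>

lemma (in prob_space) even_moment_weighted_normal_sum:
  fixes X :: "nat \<Rightarrow> 'a \<Rightarrow> real" and g :: "nat \<Rightarrow> real"
  assumes indep: "indep_vars (\<lambda>_. borel) X {..<n}"
    and normal: "\<And>i. i < n \<Longrightarrow> distributed M lborel (X i) (normal_density 0 \<tau>)"
    and \<tau>: "\<tau> > 0" and p: "p \<ge> 1"
  shows "(\<integral>\<^sup>+\<omega>. ennreal ((\<Sum>i<n. g i * X i \<omega>) ^ (2 * p)) \<partial>M)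
           \<le> ennreal (fact (2 * p) / (2 ^ p * fact p) * (\<Sum>i<n. (g i)\<^sup>2 * \<tau>\<^sup>2) ^ p)"
proof -
  \<comment> \<open>a variable with coefficient zero has no density, so these terms are dropped first\<close>
  define I where "I = {i. i < n \<and> g i \<noteq> 0}"
  have I: "finite I" "I \<subseteq> {..<n}" by (auto simp: I_def)
  have sum_I: "(\<Sum>i<n. g i * X i \<omega>) = (\<Sum>i\<in>I. g i * X i \<omega>)" for \<omega>
    using I by (intro sum.mono_neutral_right) (auto simp: I_def)
  show ?thesis
  proof (cases "I = {}")
    case True
    then show ?thesis using p by (simp add: sum_I power_0_left sum_nonneg)
  next
    case False
    define S where "S = (\<Sum>i\<in>I. (\<bar>g i\<bar> * \<tau>)\<^sup>2)"
    have S_eq: "S = (\<Sum>i<n. (g i)\<^sup>2 * \<tau>\<^sup>2)"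
      unfolding S_def using I by (intro sum.mono_neutral_cong_left) (auto simp: I_def power_mult_distrib)
    have S: "S > 0"
      unfolding S_def using I False \<tau> by (intro sum_pos) (auto simp: I_def)
    have "distributed M lborel (\<lambda>\<omega>. \<Sum>i\<in>I. g i * X i \<omega>)
            (normal_density (\<Sum>i\<in>I. 0) (sqrt (\<Sum>i\<in>I. (\<bar>g i\<bar> * \<tau>)\<^sup>2)))"
    proof (rule sum_indep_normal)
      show "indep_vars (\<lambda>i. borel) (\<lambda>i \<omega>. g i * X i \<omega>) I"
        using indep_vars_compose2[OF indep_vars_subset[OF indep I(2)], of "\<lambda>i x. g i * x" "\<lambda>_. borel"] by simp
      fix i assume i: "i \<in> I"
      then show "0 < \<bar>g i\<bar> * \<tau>" using \<tau> by (simp add: I_def)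
      show "distributed M lborel (\<lambda>\<omega>. g i * X i \<omega>) (\<lambda>x. ennreal (normal_density 0 (\<bar>g i\<bar> * \<tau>) x))"
        using normal_density_affine[OF normal[of i] \<tau>, of "g i" 0] i by (simp add: I_def)
    qed (use I False in auto)
    then have D: "distributed M lborel (\<lambda>\<omega>. \<Sum>i\<in>I. g i * X i \<omega>) (normal_density 0 (sqrt S))"
      by (simp add: S_def)
    have "(\<integral>\<^sup>+\<omega>. ennreal ((\<Sum>i\<in>I. g i * X i \<omega>) ^ (2 * p)) \<partial>M)
        = (\<integral>\<^sup>+x. ennreal (normal_density 0 (sqrt S) x) * ennreal (x ^ (2 * p)) \<partial>lborel)"
      by (rule distributed_nn_integral[OF D, symmetric]) simp
    also have "\<dots> = (\<integral>\<^sup>+x. ennreal (normal_density 0 (sqrt S) x * (x - 0) ^ (2 * p)) \<partial>lborel)"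
      by (simp add: ennreal_mult' normal_density_nonneg)
    also have "\<dots> = ennreal (fact (2 * p) / ((2 / (sqrt S)\<^sup>2) ^ p * fact p))"
      using normal_moment_even[of "sqrt S" 0 p] S
      by (subst nn_integral_eq_integral) (auto simp: has_bochner_integral_iff normal_density_nonneg)
    also have "fact (2 * p) / ((2 / (sqrt S)\<^sup>2) ^ p * fact p) = fact (2 * p) / (2 ^ p * fact p) * S ^ p"
      using S by (simp add: power_divide)
    finally show ?thesis by (simp add: sum_I S_eq)
  qed
qed

text \<open>The even moment \<open>(2 p)! / (2\<^sup>p p!)\<close> of a standard normal variable, times \<open>2\<^sup>p\<close> from comparing the
  Euclidean norm with the coordinates and times \<open>2\<close> for the number of coordinates.\<close>

definition planar_moment :: "nat \<Rightarrow> real" where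
  "planar_moment p = 2 ^ (p + 1) * (fact (2 * p) / (2 ^ p * fact p))"

lemma planar_moment_nonneg: "0 \<le> planar_moment p"
  by (simp add: planar_moment_def)

lemma norm_planar_even_power_le:
  fixes v :: "real ^ 2"
  shows "norm v ^ (2 * p) \<le> 2 ^ p * (\<Sum>j\<in>UNIV. (v $ j) ^ (2 * p))"
proof -
  have "(norm v)\<^sup>2 = (v $ 1)\<^sup>2 + (v $ 2)\<^sup>2"
    by (simp add: norm_vec_def L2_set_def sum_2 add_nonneg_nonneg)
  also have "\<dots> \<le> 2 * max ((v $ 1)\<^sup>2) ((v $ 2)\<^sup>2)" by simp
  finally have "((norm v)\<^sup>2) ^ p \<le> (2 * max ((v $ 1)\<^sup>2) ((v $ 2)\<^sup>2)) ^ p"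
    by (intro power_mono) auto
  also have "\<dots> \<le> 2 ^ p * (((v $ 1)\<^sup>2) ^ p + ((v $ 2)\<^sup>2) ^ p)"
    by (simp add: power_mult_distrib max_def)
  finally show ?thesis by (simp add: power_mult sum_2)
qed

lemma grid_reflect: "n > 0 \<Longrightarrow> m \<le> n \<Longrightarrow> t - grid 0 t n (n - m) = grid 0 t n m"
  by (simp add: grid_def field_simps of_nat_diff)

context std_planar_brownian_motion
begin

lemma reversed_path_continuous:
  assumes "\<omega> \<in> space M"
  shows "continuous_on {0..t} (\<lambda>z. W (t - z) \<omega>)"
  by (rule continuous_on_compose2[OF continuous_paths[OF assms]]) (auto intro!: continuous_intros)

lemma reversed_path_integral_measurable:
  assumes t: "0 \<le> t" and h: "continuous_on {0..t} h"
  shows "(\<lambda>\<omega>. integral {0..t} (\<lambda>z. h z *\<^sub>R W (t - z) \<omega>)) \<in> borel_measurable M"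
proof (rule borel_measurable_LIMSEQ_metric)
  fix \<omega> assume "\<omega> \<in> space M"
  then show "(\<lambda>n. \<Sum>i<n. integral {grid 0 t n i..grid 0 t n (Suc i)} h *\<^sub>R W (t - grid 0 t n i) \<omega>)
               \<longlonglongrightarrow> integral {0..t} (\<lambda>z. h z *\<^sub>R W (t - z) \<omega>)"
    using t h grid_mono[OF t] by (intro stieltjes_sums_tendsto reversed_path_continuous) auto
next
  fix n
  have "W (t - grid 0 t n i) \<in> borel_measurable M" if "i < n" for i
    using grid_in[OF t, of n i] that by (intro random_variable_W) auto
  then show "(\<lambda>\<omega>. \<Sum>i<n. integral {grid 0 t n i..grid 0 t n (Suc i)} h *\<^sub>R W (t - grid 0 t n i) \<omega>)
     \<in> borel_measurable M"
    by (intro borel_measurable_sum borel_measurable_scaleR) auto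
qed

text \<open>Each coordinate of the sum is normal with variance \<open>\<Sum> g\<^sub>m\<^sup>2 t / n\<close>, being a linear combination of
  independent normal increments.\<close>

lemma wiener_sum_moment:
  assumes t: "0 < t" and n: "n > 0" and p: "p \<ge> 1"
  shows "(\<integral>\<^sup>+\<omega>. ennreal (norm (\<Sum>m<n. g m *\<^sub>R (W (grid 0 t n (Suc m)) \<omega> - W (grid 0 t n m) \<omega>)) ^ (2 * p)) \<partial>M)
     \<le> ennreal (planar_moment p * (\<Sum>m<n. (g m)\<^sup>2 * (t / real n)) ^ p)"
proof -
  let ?X = "\<lambda>m \<omega>. W (grid 0 t n (Suc m)) \<omega> - W (grid 0 t n m) \<omega>"
  let ?S = "\<lambda>\<omega>. \<Sum>m<n. g m *\<^sub>R ?X m \<omega>"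
  let ?m = "fact (2 * p) / (2 ^ p * fact p) * (\<Sum>m<n. (g m)\<^sup>2 * (t / real n)) ^ p :: real"
  have mono: "mono (grid 0 t n)" using t by (intro monoI grid_mono) auto
  have indep: "indep_vars (\<lambda>_. borel) ?X {..<n}"
    by (rule indep_increments[OF _ mono]) simp
  have rv: "?X m \<in> borel_measurable M" for m
    using grid_mono[of 0 t 0 _ n] t by (intro borel_measurable_diff random_variable_W) auto
  have less: "grid 0 t n m < grid 0 t n (Suc m)" for m
  proof -
    have "0 < grid 0 t n (Suc m) - grid 0 t n m"
      unfolding grid_step using t n by simp
    then show ?thesis by simp
  qed
  have coord: "(\<integral>\<^sup>+\<omega>. ennreal ((?S \<omega> $ j) ^ (2 * p)) \<partial>M) \<le> ennreal ?m" for j :: 2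
  proof -
    have "(\<integral>\<^sup>+\<omega>. ennreal ((\<Sum>m<n. g m * (?X m \<omega> $ j)) ^ (2 * p)) \<partial>M)
      \<le> ennreal (fact (2 * p) / (2 ^ p * fact p) * (\<Sum>m<n. (g m)\<^sup>2 * (sqrt (t / real n))\<^sup>2) ^ p)"
    proof (rule even_moment_weighted_normal_sum)
      show "indep_vars (\<lambda>_. borel) (\<lambda>m \<omega>. ?X m \<omega> $ j) {..<n}"
        using indep_vars_compose2[OF indep, of "\<lambda>_ v. v $ j" "\<lambda>_. borel"] by simp
      show "distributed M lborel (\<lambda>\<omega>. ?X m \<omega> $ j) (normal_density 0 (sqrt (t / real n)))" for m
        using normal_coordinates[OF _ less[of m], of j] grid_step[of 0 t n m] grid_mono[of 0 t 0 m n] t by simp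
    qed (use t n p in auto)
    then show ?thesis using t by simp
  qed
  have "(\<integral>\<^sup>+\<omega>. ennreal (norm (?S \<omega>) ^ (2 * p)) \<partial>M)
     \<le> (\<integral>\<^sup>+\<omega>. (\<Sum>j\<in>UNIV. ennreal (2 ^ p) * ennreal ((?S \<omega> $ j) ^ (2 * p))) \<partial>M)"
  proof (rule nn_integral_mono)
    fix \<omega>
    show "ennreal (norm (?S \<omega>) ^ (2 * p)) \<le> (\<Sum>j\<in>UNIV. ennreal (2 ^ p) * ennreal ((?S \<omega> $ j) ^ (2 * p)))"
    proof -
      have "(\<Sum>j\<in>UNIV. ennreal (2 ^ p) * ennreal ((?S \<omega> $ j) ^ (2 * p)))
          = (\<Sum>j\<in>UNIV. ennreal (2 ^ p * (?S \<omega> $ j) ^ (2 * p)))"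
        by (intro sum.cong refl ennreal_mult'[symmetric]) simp
      also have "\<dots> = ennreal (2 ^ p * (\<Sum>j\<in>UNIV. (?S \<omega> $ j) ^ (2 * p)))"
        unfolding sum_distrib_left by (rule sum_ennreal) (simp add: zero_le_even_power')
      finally show ?thesis
        using ennreal_leI[OF norm_planar_even_power_le[of "?S \<omega>" p]] by simp
    qed
  qed
  also have "\<dots> = (\<Sum>j\<in>UNIV. ennreal (2 ^ p) * (\<integral>\<^sup>+\<omega>. ennreal ((?S \<omega> $ j) ^ (2 * p)) \<partial>M))"
  proof -
    have "(\<lambda>\<omega>. ?S \<omega> $ j) \<in> borel_measurable M" for j
      by (intro measurable_compose[OF _ borel_measurable_continuous_onI[of "\<lambda>v. v $ j"]] continuous_intros borel_measurable_sum
          borel_measurable_scaleR borel_measurable_const rv)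
    then have meas: "(\<lambda>\<omega>. ennreal ((?S \<omega> $ j) ^ (2 * p))) \<in> borel_measurable M" for j
      by (intro measurable_compose[OF _ measurable_ennreal] borel_measurable_power)
    show ?thesis
      by (subst nn_integral_sum, intro borel_measurable_times_ennreal meas borel_measurable_const)
        (intro sum.cong refl nn_integral_cmult meas)
  qed
  also have "\<dots> \<le> (\<Sum>j\<in>(UNIV::2 set). ennreal (2 ^ p) * ennreal ?m)"
    by (intro sum_mono mult_left_mono coord) auto
  also have "\<dots> = ennreal (2 ^ (p + 1) * ?m)"
  proof -
    have "0 \<le> ?m" using t by (simp add: sum_nonneg)
    moreover have "ennreal (2 ^ p) * ennreal y + ennreal (2 ^ p) * ennreal y = ennreal (2 ^ (p + 1) * y)"
      if "0 \<le> y" for y :: real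
      using that by (simp add: ennreal_mult'[symmetric] ennreal_plus[symmetric] del: ennreal_plus)
    ultimately show ?thesis unfolding sum_2 by blast
  qed
  finally show ?thesis unfolding planar_moment_def by (simp only: mult.assoc)
qed

text \<open>Integration by parts for the path, carried out on Riemann-Stieltjes sums: a sum of values of \<open>W\<close>
  against increments of \<open>G\<close> becomes a sum of values of \<open>G\<close> against increments of \<open>W\<close>, whose moments are
  known and whose variance is itself a Riemann sum of \<open>G\<^sup>2\<close>.\<close>

lemma reversed_path_integral_moment:
  assumes t: "0 < t" and p: "p \<ge> 1"
    and h: "continuous_on {0..t} h" and G: "continuous_on {0..t} G" "G 0 = 0"
    and deriv: "\<And>z. z \<in> {0<..<t} \<Longrightarrow> (G has_real_derivative h z) (at z)"
  shows "(\<integral>\<^sup>+\<omega>. ennreal (norm (integral {0..t} (\<lambda>z. h z *\<^sub>R W (t - z) \<omega>)) ^ (2 * p)) \<partial>M)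
     \<le> ennreal (planar_moment p * (integral {0..t} (\<lambda>z. (G z)\<^sup>2)) ^ p)"
proof (rule nn_integral_tendsto_le)
  \<comment> \<open>in the time \<open>s = t - z\<close> of the path, so that the increments come in their natural order\<close>
  define S where "S = (\<lambda>n \<omega>. \<Sum>m<n. G (grid 0 t n (n - m)) *\<^sub>R (W (grid 0 t n (Suc m)) \<omega> - W (grid 0 t n m) \<omega>))"
  have t0: "0 \<le> t" using t by simp
  have sum_eq: "(\<Sum>i<n. integral {grid 0 t n i..grid 0 t n (Suc i)} h *\<^sub>R W (t - grid 0 t n i) \<omega>) = S n \<omega>"
    if \<omega>: "\<omega> \<in> space M" and n: "n > 0" for n \<omega>
  proof -
    let ?z = "grid 0 t n" and ?w = "\<lambda>i. W (t - grid 0 t n i) \<omega>"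
    have "(\<Sum>i<n. integral {?z i..?z (Suc i)} h *\<^sub>R ?w i) = (\<Sum>i<n. (G (?z (Suc i)) - G (?z i)) *\<^sub>R ?w i)"
    proof (rule sum.cong[OF refl])
      fix i assume "i \<in> {..<n}"
      then have zi: "?z i \<in> {0..t}" "?z (Suc i) \<in> {0..t}" "?z i \<le> ?z (Suc i)"
        using grid_in[OF t0 n] grid_mono[OF t0, of i "Suc i" n] by auto
      have "(h has_integral (G (?z (Suc i)) - G (?z i))) {?z i..?z (Suc i)}"
        using zi by (intro fundamental_theorem_of_calculus_interior continuous_on_subset[OF G(1)])
          (auto simp: has_real_derivative_iff_has_vector_derivative[symmetric] intro!: deriv)
      then show "integral {?z i..?z (Suc i)} h *\<^sub>R ?w i = (G (?z (Suc i)) - G (?z i)) *\<^sub>R ?w i"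
        by (simp add: integral_unique)
    qed
    also have "\<dots> = (\<Sum>i<n. G (?z (Suc i)) *\<^sub>R (?w i - ?w (Suc i)))"
      using abel_summation[of "\<lambda>i. G (?z i)" ?w n] n G(2) W_0[OF \<omega>] by simp
    also have "\<dots> = (\<Sum>m<n. G (?z (Suc (n - Suc m))) *\<^sub>R (?w (n - Suc m) - ?w (Suc (n - Suc m))))"
      by (rule sum.nat_diff_reindex[symmetric])
    also have "\<dots> = S n \<omega>"
      unfolding S_def using n by (intro sum.cong) (auto simp: Suc_diff_Suc grid_reflect)
    finally show ?thesis .
  qed
  have "W (grid 0 t n m) \<in> borel_measurable M" for n m
    using grid_mono[OF t0, of 0 m n] by (intro random_variable_W) auto
  then have "S n \<in> borel_measurable M" for n
    unfolding S_def by (intro borel_measurable_sum borel_measurable_scaleR borel_measurable_diff) auto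
  then show "(\<lambda>\<omega>. norm (S n \<omega>) ^ (2 * p)) \<in> borel_measurable M" for n
    by measurable
  show "(\<lambda>n. norm (S n \<omega>) ^ (2 * p)) \<longlonglongrightarrow> norm (integral {0..t} (\<lambda>z. h z *\<^sub>R W (t - z) \<omega>)) ^ (2 * p)"
    if \<omega>: "\<omega> \<in> space M" for \<omega>
  proof (intro tendsto_intros)
    have "(\<lambda>n. \<Sum>i<n. integral {grid 0 t n i..grid 0 t n (Suc i)} h *\<^sub>R W (t - grid 0 t n i) \<omega>)
        \<longlonglongrightarrow> integral {0..t} (\<lambda>z. h z *\<^sub>R W (t - z) \<omega>)"
      using h grid_mono[OF t0] by (intro stieltjes_sums_tendsto reversed_path_continuous t0 \<omega>) auto
    then show "(\<lambda>n. S n \<omega>) \<longlonglongrightarrow> integral {0..t} (\<lambda>z. h z *\<^sub>R W (t - z) \<omega>)"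
      by (rule Lim_transform_eventually)
        (use sum_eq[OF \<omega>] in \<open>auto intro!: eventually_mono[OF eventually_gt_at_top[of 0]]\<close>)
  qed
  define c where "c = (\<lambda>n. planar_moment p
      * (\<Sum>m<n. (G (grid 0 t n (n - m)))\<^sup>2 * (t / real n)) ^ p)"
  show "(\<integral>\<^sup>+\<omega>. ennreal (norm (S n \<omega>) ^ (2 * p)) \<partial>M) \<le> ennreal (c n)" if "n > 0" for n
    unfolding S_def c_def by (rule wiener_sum_moment[OF t that p])
  have "(\<lambda>n. \<Sum>i<n. integral {grid 0 t n i..grid 0 t n (Suc i)} (\<lambda>_. 1) *\<^sub>R (G (grid 0 t n (Suc i)))\<^sup>2)
     \<longlonglongrightarrow> integral {0..t} (\<lambda>z. 1 *\<^sub>R (G z)\<^sup>2)"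
    using grid_mono[OF t0] by (intro stieltjes_sums_tendsto t0 continuous_intros G) auto
  also have "(\<lambda>n. \<Sum>i<n. integral {grid 0 t n i..grid 0 t n (Suc i)} (\<lambda>_. 1) *\<^sub>R (G (grid 0 t n (Suc i)))\<^sup>2)
     = (\<lambda>n. \<Sum>i<n. (G (grid 0 t n (Suc i)))\<^sup>2 * (t / real n))"
    using grid_mono[OF t0] grid_step[of 0 t] by (intro ext sum.cong) auto
  also have "\<dots> = (\<lambda>n. \<Sum>m<n. (G (grid 0 t n (n - m)))\<^sup>2 * (t / real n))"
  proof
    fix n show "(\<Sum>i<n. (G (grid 0 t n (Suc i)))\<^sup>2 * (t / real n)) = (\<Sum>m<n. (G (grid 0 t n (n - m)))\<^sup>2 * (t / real n))"
      by (subst sum.nat_diff_reindex[symmetric]) (auto intro!: sum.cong simp: Suc_diff_Suc)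
  qed
  finally show "c \<longlonglongrightarrow> planar_moment p * (integral {0..t} (\<lambda>z. (G z)\<^sup>2)) ^ p"
    unfolding c_def by (intro tendsto_intros) simp
qed

lemma reversed_path_integral_moment_le:
  assumes t: "0 < t" and p: "p \<ge> 1"
    and h: "continuous_on {0..t} h" and G: "continuous_on {0..t} G" "G 0 = 0"
    and deriv: "\<And>z. z \<in> {0<..<t} \<Longrightarrow> (G has_real_derivative h z) (at z)"
    and le: "integral {0..t} (\<lambda>z. (G z)\<^sup>2) \<le> B"
  shows "(\<integral>\<^sup>+\<omega>. ennreal (norm (integral {0..t} (\<lambda>z. h z *\<^sub>R W (t - z) \<omega>)) ^ (2 * p)) \<partial>M)
     \<le> ennreal (planar_moment p * B ^ p)"
proof -
  have "0 \<le> integral {0..t} (\<lambda>z. (G z)\<^sup>2)"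
    by (intro integral_nonneg integrable_continuous_real continuous_intros G) auto
  then have "(integral {0..t} (\<lambda>z. (G z)\<^sup>2)) ^ p \<le> B ^ p"
    using le by (intro power_mono)
  then have "planar_moment p * (integral {0..t} (\<lambda>z. (G z)\<^sup>2)) ^ p \<le> planar_moment p * B ^ p"
    by (rule mult_left_mono[OF _ planar_moment_nonneg])
  then have le': "ennreal (planar_moment p * (integral {0..t} (\<lambda>z. (G z)\<^sup>2)) ^ p)
      \<le> ennreal (planar_moment p * B ^ p)"
    by (rule ennreal_leI)
  show ?thesis
    by (rule order_trans[OF reversed_path_integral_moment[OF t p h G] le']) (rule deriv)
qed

end

section \<open>Calculus of the kernel\<close>

text \<open>The kernel and all derivatives used below are combinations, with coefficients polynomial in \<open>x\<close> and \<open>z\<close>, of these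
  functions for half-integer \<open>m\<close>. At \<open>z = 0\<close> the value is \<open>0\<close>, since \<open>0 powr (- m) = 0\<close>, and this is the
  continuous extension as long as \<open>x > 0\<close>.\<close>

definition damped :: "real \<Rightarrow> real \<Rightarrow> real \<Rightarrow> real \<Rightarrow> real" where
  "damped \<alpha> m x z = z powr (-m) * exp (- ((x - \<alpha> * z)\<^sup>2 / (2 * (conga_sigma \<alpha>)\<^sup>2 * z)))"

lemma conga_sigma_pos: "0 < \<alpha> \<Longrightarrow> \<alpha> < 1 \<Longrightarrow> 0 < conga_sigma \<alpha>"
  by (simp add: conga_sigma_def)

lemma damped_0 [simp]: "damped \<alpha> m x 0 = 0"
  by (simp add: damped_def)

lemma damped_shift: "z > 0 \<Longrightarrow> damped \<alpha> m x z = z * damped \<alpha> (m + 1) x z"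
  by (simp add: damped_def powr_diff powr_minus powr_add field_simps)

lemma damped_deriv_x:
  assumes \<sigma>: "conga_sigma \<alpha> > 0" and z: "z \<ge> 0"
  shows "((\<lambda>x. damped \<alpha> m x z) has_real_derivative
           - (x - \<alpha> * z) / (conga_sigma \<alpha>)\<^sup>2 * damped \<alpha> (m + 1) x z) (at x)"
proof (cases "z = 0")
  case False
  then have z: "z > 0" using z by simp
  define s where "s = (conga_sigma \<alpha>)\<^sup>2"
  have s: "s > 0" using \<sigma> by (simp add: s_def)
  have q: "((\<lambda>x. - ((x - \<alpha> * z)\<^sup>2 / (2 * s * z))) has_real_derivative - ((x - \<alpha> * z) / (s * z))) (at x)"
    using z s by (auto intro!: derivative_eq_intros simp: field_simps)
  have pw: "z powr (- (m + 1)) = z powr (- m) / z"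
    using z by (simp add: powr_diff)
  have "((\<lambda>x. z powr (- m) * exp (- ((x - \<alpha> * z)\<^sup>2 / (2 * s * z)))) has_real_derivative
      z powr (- m) * (exp (- ((x - \<alpha> * z)\<^sup>2 / (2 * s * z))) * (- ((x - \<alpha> * z) / (s * z))))) (at x)"
    by (intro DERIV_cmult DERIV_chain2[OF DERIV_exp] q)
  then show ?thesis
    unfolding damped_def s_def[symmetric] pw
    by (rule DERIV_cong) (use z s in \<open>simp add: field_simps\<close>)
qed simp

lemma damped_deriv_z:
  assumes \<sigma>: "conga_sigma \<alpha> > 0" and z: "z > 0"
  shows "((\<lambda>z. damped \<alpha> m x z) has_real_derivative
           - m * damped \<alpha> (m + 1) x z
           + (x\<^sup>2 - \<alpha>\<^sup>2 * z\<^sup>2) / (2 * (conga_sigma \<alpha>)\<^sup>2) * damped \<alpha> (m + 2) x z) (at z)"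
proof -
  define s where "s = (conga_sigma \<alpha>)\<^sup>2"
  have s: "s > 0" using \<sigma> by (simp add: s_def)
  have pw: "z powr (- m - 1) = z powr (- m) / z" "z powr (- (m + 1)) = z powr (- m) / z"
     "z powr (- (m + 2)) = z powr (- m) / z\<^sup>2"
    using z by (simp_all add: powr_diff powr_minus powr_add field_simps power2_eq_square)
  have q: "((\<lambda>z. - ((x - \<alpha> * z)\<^sup>2 / (2 * s * z))) has_real_derivative (x\<^sup>2 - \<alpha>\<^sup>2 * z\<^sup>2) / (2 * s * z\<^sup>2)) (at z)"
    using z s by (auto intro!: derivative_eq_intros simp: field_simps power2_eq_square)
  have p: "((\<lambda>z. z powr (- m)) has_real_derivative - m * z powr (- m - 1)) (at z)"
    using z by (auto intro!: derivative_eq_intros)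
  have "((\<lambda>z. z powr (- m) * exp (- ((x - \<alpha> * z)\<^sup>2 / (2 * s * z)))) has_real_derivative
      (- m * z powr (- m - 1)) * exp (- ((x - \<alpha> * z)\<^sup>2 / (2 * s * z)))
      + exp (- ((x - \<alpha> * z)\<^sup>2 / (2 * s * z))) * ((x\<^sup>2 - \<alpha>\<^sup>2 * z\<^sup>2) / (2 * s * z\<^sup>2)) * z powr (- m)) (at z)"
    by (intro DERIV_mult p DERIV_chain2[OF DERIV_exp] q)
  then show ?thesis
    unfolding damped_def s_def[symmetric] pw
    by (rule DERIV_cong) (use z s in \<open>simp add: field_simps\<close>)
qed

text \<open>The only delicate points are \<open>(x\<^sub>0, 0)\<close>: near them the exponent is at most \<open>- c / z\<close> with a fixed \<open>c > 0\<close>,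
  which beats every power of \<open>1 / z\<close>.\<close>

lemma damped_continuous:
  assumes \<alpha>: "0 < \<alpha>" and \<sigma>: "conga_sigma \<alpha> > 0"
  shows "continuous_on ({0<..} \<times> {0..}) (\<lambda>(x, z). damped \<alpha> m x z)"
proof -
  let ?S = "{0<..} \<times> {0..} :: (real \<times> real) set"
  define s where "s = (conga_sigma \<alpha>)\<^sup>2"
  have s: "s > 0" using \<sigma> by (simp add: s_def)
  have "((\<lambda>(x, z). damped \<alpha> m x z) \<longlongrightarrow> damped \<alpha> m x0 z0) (at (x0, z0) within ?S)"
    if x0: "x0 > 0" and z0: "z0 \<ge> 0" for x0 z0
  proof (cases "z0 = 0")
    case False
    then have "isCont (\<lambda>p. damped \<alpha> m (fst p) (snd p)) (x0, z0)"
      using z0 s unfolding damped_def s_def[symmetric] by (intro continuous_intros) auto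
    then show ?thesis
      by (auto simp: case_prod_unfold isCont_def intro: tendsto_within_subset)
  next
    case True
    \<comment> \<open>near \<open>(x0, 0)\<close> the distance \<open>x - \<alpha> z\<close> is at least \<open>x0 / 4\<close>, which gives \<open>(x0 / 4)\<^sup>2 / (2 s z)\<close> in the exponent\<close>
    define c where "c = x0\<^sup>2 / (32 * s)"
    have c: "c > 0" using x0 s by (simp add: c_def)
    define \<psi> where "\<psi> = (\<lambda>z::real. z powr (-m) * exp (- (c / z)))"
    have "continuous_on {0..} \<psi>"
      unfolding continuous_on_def
    proof
      fix z :: real assume z: "z \<in> {0..}"
      show "(\<psi> \<longlongrightarrow> \<psi> z) (at z within {0..})"
      proof (cases "z = 0")
        case True
        have "((\<lambda>z::real. z powr (-m) * exp (- (c / z))) \<longlongrightarrow> 0) (at_right 0)"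
          using c by real_asymp
        then show ?thesis using True by (simp add: \<psi>_def at_within_Ici_at_right)
      next
        case False
        then have "isCont \<psi> z"
          using z unfolding \<psi>_def by (intro continuous_intros) auto
        then show ?thesis by (auto simp: isCont_def intro: tendsto_within_subset)
      qed
    qed
    then have "continuous_on ?S (\<lambda>p. \<psi> (snd p))"
      by (rule continuous_on_compose2) (auto intro!: continuous_intros)
    then have "((\<lambda>p. \<psi> (snd p)) \<longlongrightarrow> \<psi> 0) (at (x0, 0) within ?S)"
      using x0 by (auto simp: continuous_on_def)
    then have lim: "((\<lambda>p. \<psi> (snd p)) \<longlongrightarrow> 0) (at (x0, 0) within ?S)"
      by (simp add: \<psi>_def)
    have open_N: "open ({x0 / 2<..} \<times> {..<x0 / (4 * \<alpha>)})"
      by (intro open_Times) auto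
    have "((\<lambda>(x, z). damped \<alpha> m x z) \<longlongrightarrow> 0) (at (x0, 0) within ?S)"
    proof (rule Lim_null_comparison[OF _ lim])
      have "\<forall>\<^sub>F p in at (x0, 0) within ?S. p \<in> ({x0 / 2<..} \<times> {..<x0 / (4 * \<alpha>)}) \<and> p \<in> ?S"
        using x0 \<alpha> by (intro eventually_conj)
          (auto simp: eventually_at_topological intro!: exI[of _ "{x0 / 2<..} \<times> {..<x0 / (4 * \<alpha>)}"] open_N)
      then show "\<forall>\<^sub>F p in at (x0, 0) within ?S. norm (case p of (x, z) \<Rightarrow> damped \<alpha> m x z) \<le> \<psi> (snd p)"
      proof (rule eventually_mono, clarify, simp)
        fix x z :: real assume *: "x0 < x * 2" "z < x0 / (4 * \<alpha>)" "0 < x" "0 \<le> z"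
        show "\<bar>damped \<alpha> m x z\<bar> \<le> \<psi> z"
        proof (cases "z = 0")
          case False
          then have z: "z > 0" using * by simp
          have "x - \<alpha> * z \<ge> x0 / 4" using * \<alpha> by (simp add: field_simps)
          then have "(x0 / 4)\<^sup>2 \<le> (x - \<alpha> * z)\<^sup>2" using x0 by (intro power_mono) auto
          then have "c / z \<le> (x - \<alpha> * z)\<^sup>2 / (2 * s * z)"
            using s z by (simp add: c_def power_divide field_simps)
          then show ?thesis
            unfolding damped_def \<psi>_def s_def[symmetric] by (simp add: abs_mult mult_left_mono)
        qed (simp add: \<psi>_def)
      qed
    qed
    with True show ?thesis by simp
  qed
  then show ?thesis unfolding continuous_on_def by auto
qed

definition kappa :: "real \<Rightarrow> real" where
  "kappa \<alpha> = 1 / (2 * conga_sigma \<alpha> * sqrt (2 * pi))"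

definition kernel_dx :: "real \<Rightarrow> real \<Rightarrow> real \<Rightarrow> real" where
  "kernel_dx \<alpha> x z = kappa \<alpha> * (damped \<alpha> (3/2) x z
     - (x\<^sup>2 - \<alpha>\<^sup>2 * z\<^sup>2) / (conga_sigma \<alpha>)\<^sup>2 * damped \<alpha> (5/2) x z)"

definition kernel_dxx :: "real \<Rightarrow> real \<Rightarrow> real \<Rightarrow> real" where
  "kernel_dxx \<alpha> x z = kappa \<alpha> * ((\<alpha> * z - 3 * x) / (conga_sigma \<alpha>)\<^sup>2 * damped \<alpha> (5/2) x z
     + (x\<^sup>2 - \<alpha>\<^sup>2 * z\<^sup>2) * (x - \<alpha> * z) / (conga_sigma \<alpha>) ^ 4 * damped \<alpha> (7/2) x z)"

text \<open>The first two \<open>x\<close>-derivatives of the mass \<open>F(x, z) = \<Phi> ((\<alpha> z - x) / (\<sigma> sqrt z))\<close>, that is, of the integral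
  of the kernel over \<open>{0..z}\<close>. Their \<open>z\<close>-derivatives are the \<open>x\<close>-derivatives of the kernel.\<close>

definition mass_dx :: "real \<Rightarrow> real \<Rightarrow> real \<Rightarrow> real" where
  "mass_dx \<alpha> x z = - 2 * kappa \<alpha> * damped \<alpha> (1/2) x z"

definition mass_dxx :: "real \<Rightarrow> real \<Rightarrow> real \<Rightarrow> real" where
  "mass_dxx \<alpha> x z = 2 * kappa \<alpha> * (x - \<alpha> * z) / (conga_sigma \<alpha>)\<^sup>2 * damped \<alpha> (3/2) x z"

lemma conga_kernel_damped:
  "conga_kernel \<alpha> x z = kappa \<alpha> * ((x + \<alpha> * z) * damped \<alpha> (3/2) x z)"
  by (simp add: conga_kernel_def kappa_def damped_def powr_minus field_simps)

lemma conga_kernel_deriv_x: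
  assumes \<sigma>: "conga_sigma \<alpha> > 0" and z: "z \<ge> 0"
  shows "((\<lambda>x. conga_kernel \<alpha> x z) has_real_derivative kernel_dx \<alpha> x z) (at x)"
  unfolding conga_kernel_damped kernel_dx_def
  by (rule derivative_eq_intros damped_deriv_x refl \<sigma> z)+
     (use \<sigma> in \<open>simp add: field_simps power2_eq_square\<close>)

lemma kernel_dx_deriv_x:
  assumes \<sigma>: "conga_sigma \<alpha> > 0" and z: "z \<ge> 0"
  shows "((\<lambda>x. kernel_dx \<alpha> x z) has_real_derivative kernel_dxx \<alpha> x z) (at x)"
proof -
  have [simp]: "3/2 + 1 = (5/2::real)" "5/2 + 1 = (7/2::real)" by auto
  show ?thesis
    unfolding kernel_dxx_def kernel_dx_def
    by (rule derivative_eq_intros damped_deriv_x refl \<sigma> z | use \<sigma> in simp; fail)+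
       (use \<sigma> in \<open>simp add: field_simps power2_eq_square power4_eq_xxxx\<close>)
qed

lemma mass_dx_deriv_z:
  assumes \<sigma>: "conga_sigma \<alpha> > 0" and z: "z > 0"
  shows "((\<lambda>z. mass_dx \<alpha> x z) has_real_derivative kernel_dx \<alpha> x z) (at z)"
proof -
  have [simp]: "1/2 + 1 = (3/2::real)" "1/2 + 2 = (5/2::real)" by auto
  show ?thesis
    unfolding mass_dx_def kernel_dx_def
    by (rule derivative_eq_intros damped_deriv_z refl \<sigma> z)+
       (use \<sigma> in \<open>simp add: field_simps\<close>)
qed

lemma mass_dxx_deriv_z:
  assumes \<sigma>: "conga_sigma \<alpha> > 0" and z: "z > 0"
  shows "((\<lambda>z. mass_dxx \<alpha> x z) has_real_derivative kernel_dxx \<alpha> x z) (at z)"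
proof -
  have [simp]: "3/2 + 1 = (5/2::real)" "3/2 + 2 = (7/2::real)" by auto
  have *: "damped \<alpha> (3/2) x z = z * damped \<alpha> (5/2) x z"
    using damped_shift[OF z, of \<alpha> "3/2" x] by simp
  show ?thesis
    unfolding mass_dxx_def kernel_dxx_def
    by (rule derivative_eq_intros damped_deriv_z refl \<sigma> z | use \<sigma> in simp; fail)+
       (use \<sigma> in \<open>simp add: * field_simps power2_eq_square power4_eq_xxxx\<close>)
qed

lemma mass_at_0 [simp]: "mass_dx \<alpha> x 0 = 0" "mass_dxx \<alpha> x 0 = 0"
  by (simp_all add: mass_dx_def mass_dxx_def)

lemma kernels_continuous:
  assumes \<alpha>: "0 < \<alpha>" and \<sigma>: "conga_sigma \<alpha> > 0"
  shows "continuous_on ({0<..} \<times> {0..}) (\<lambda>(x, z). conga_kernel \<alpha> x z)"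
    and "continuous_on ({0<..} \<times> {0..}) (\<lambda>(x, z). kernel_dx \<alpha> x z)"
    and "continuous_on ({0<..} \<times> {0..}) (\<lambda>(x, z). kernel_dxx \<alpha> x z)"
    and "continuous_on ({0<..} \<times> {0..}) (\<lambda>(x, z). mass_dx \<alpha> x z)"
    and "continuous_on ({0<..} \<times> {0..}) (\<lambda>(x, z). mass_dxx \<alpha> x z)"
  using \<sigma> unfolding conga_kernel_damped kernel_dx_def kernel_dxx_def mass_dx_def mass_dxx_def case_prod_unfold
  by (auto intro!: continuous_intros damped_continuous[OF \<alpha> \<sigma>, unfolded case_prod_unfold])

lemma continuous_on_section:
  assumes "continuous_on ({0<..} \<times> {0..}) (\<lambda>(x, z). F x z)" "(x::real) > 0"
  shows "continuous_on {0..t::real} (F x)"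
proof -
  have "continuous_on {0..t} (\<lambda>z. (\<lambda>(x, z). F x z) (x, z))"
    by (rule continuous_on_compose2[OF assms(1)]) (use assms(2) in \<open>auto intro!: continuous_intros\<close>)
  then show ?thesis by simp
qed

section \<open>Square integrals of the differentiated mass\<close>

text \<open>Gaussian factors are traded for \<open>1 / (1 + q)\<close>, which leads to integrals with an antiderivative
  in terms of the arc tangent.\<close>

lemma exp_minus_bounds:
  fixes q :: real assumes "q \<ge> 0"
  shows "exp (- q) \<le> 1 / (1 + q)" "q * exp (- q) \<le> 2 / (1 + q)" "q\<^sup>2 * exp (- q) \<le> 6 / (1 + q)"
proof -
  have e: "(\<Sum>i<4. q ^ i / fact i) \<le> exp q"
  proof -
    have "(\<lambda>n. q ^ n / fact n) sums exp q"
      using exp_converges[of q] by (simp add: divide_inverse mult.commute)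
    then have "summable (\<lambda>n. q ^ n / fact n)" "suminf (\<lambda>n. q ^ n / fact n) = exp q"
      by (simp_all add: sums_iff)
    then show ?thesis
      using sum_le_suminf[of "\<lambda>n. q ^ n / fact n" "{..<4}"] assms by simp
  qed
  have e: "1 + q + q\<^sup>2 / 2 + q ^ 3 / 6 \<le> exp q"
    using e by (simp add: eval_nat_numeral)
  have q3: "q ^ 3 \<ge> 0" "q\<^sup>2 \<ge> 0" using assms by auto
  have "1 + q \<le> exp q" using e q3 by linarith
  then show "exp (- q) \<le> 1 / (1 + q)" using assms by (simp add: exp_minus field_simps)
  have "q * (1 + q) \<le> 2 * exp q" proof -
    have "q * (1 + q) = q + q\<^sup>2" by (simp add: algebra_simps power2_eq_square)
    then show ?thesis using e q3 assms by linarith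
  qed
  then show "q * exp (- q) \<le> 2 / (1 + q)" using assms by (simp add: exp_minus field_simps)
  have "q\<^sup>2 * (1 + q) \<le> 6 * exp q" proof -
    have "q\<^sup>2 * (1 + q) = q\<^sup>2 + q ^ 3" by (simp add: algebra_simps power2_eq_square power3_eq_cube)
    then show ?thesis using e q3 assms by linarith
  qed
  then show "q\<^sup>2 * exp (- q) \<le> 6 / (1 + q)" using assms by (simp add: exp_minus field_simps)
qed

lemma passage_arctan_limit:
  fixes \<alpha> x \<sigma> :: real
  assumes "x > 0" "\<alpha> > 0" "\<sigma> > 0"
  shows "((\<lambda>z. arctan ((\<alpha> * z - x) / (\<sigma> * sqrt z))) \<longlongrightarrow> - (pi / 2)) (at_right 0)"
  using assms by real_asymp

text \<open>With \<open>v(z) = (\<alpha> z - x) / (\<sigma> sqrt z)\<close> the derivative is \<open>v' / (1 + v\<^sup>2)\<close>. Since \<open>v\<close> is the argument of \<open>\<Phi>\<close> in the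
  mass, this is the kernel with the normal density replaced by a Cauchy density, up to a constant.\<close>

lemma passage_arctan_deriv:
  fixes \<alpha> x \<sigma> :: real
  assumes z: "z > 0" and \<sigma>: "\<sigma> > 0"
  shows "((\<lambda>z. arctan ((\<alpha> * z - x) / (\<sigma> * sqrt z))) has_real_derivative
      (x + \<alpha> * z) / (2 * \<sigma> * z * sqrt z) / (1 + (x - \<alpha> * z)\<^sup>2 / (\<sigma>\<^sup>2 * z))) (at z)"
proof -
  define r where "r = sqrt z"
  have r: "r > 0" "z = r\<^sup>2" using z by (simp_all add: r_def)
  have "((\<lambda>z. (\<alpha> * z - x) / (\<sigma> * sqrt z)) has_real_derivative (x + \<alpha> * z) / (2 * \<sigma> * z * sqrt z)) (at z)"
  proof -
    have "((\<lambda>z. (\<alpha> * z - x) / (\<sigma> * sqrt z)) has_real_derivative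
      (\<alpha> * (\<sigma> * sqrt z) - (\<alpha> * z - x) * (\<sigma> * (inverse (sqrt z) / 2))) / (\<sigma> * sqrt z * (\<sigma> * sqrt z))) (at z)"
      using z \<sigma> by (auto intro!: derivative_eq_intros)
    moreover have "(\<alpha> * (\<sigma> * r) - (\<alpha> * z - x) * (\<sigma> * (inverse r / 2))) / (\<sigma> * r * (\<sigma> * r))
        = (x + \<alpha> * z) / (2 * \<sigma> * z * r)"
      using r(1) \<sigma> unfolding r(2) by (simp add: field_simps power2_eq_square)
    ultimately show ?thesis unfolding r_def by simp
  qed
  from DERIV_chain2[OF DERIV_arctan this]
  have "((\<lambda>z. arctan ((\<alpha> * z - x) / (\<sigma> * sqrt z))) has_real_derivative
      inverse (1 + ((\<alpha> * z - x) / (\<sigma> * sqrt z))\<^sup>2) * ((x + \<alpha> * z) / (2 * \<sigma> * z * sqrt z))) (at z)" .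
  moreover have "((\<alpha> * z - x) / (\<sigma> * sqrt z))\<^sup>2 = (x - \<alpha> * z)\<^sup>2 / (\<sigma>\<^sup>2 * z)"
    using z by (simp add: power_divide power_mult_distrib power2_commute)
  moreover have "inverse D * N = N / D" for D N :: real by (simp add: divide_inverse)
  ultimately show ?thesis by (simp only:)
qed

text \<open>The arithmetic-geometric mean inequality \<open>2 sqrt (\<alpha> x z) \<le> x + \<alpha> z\<close> bounds \<open>1 / z\<close> by a multiple of
  \<open>x\<^sup>-\<^sup>1\<^sup>/\<^sup>2\<close> times the factor \<open>v'\<close> of the preceding derivative, and the arc tangent varies by at most \<open>\<pi>\<close>.\<close>

lemma integral_passage_bound:
  fixes \<alpha> x \<sigma> t K :: real
  assumes x: "x > 0" and \<alpha>: "\<alpha> > 0" and \<sigma>: "\<sigma> > 0" and t: "t > 0" and K: "K \<ge> 0"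
    and F: "continuous_on {0..t} F" "F 0 \<le> 0"
    and bound: "\<And>z. z > 0 \<Longrightarrow> F z \<le> K * (1 / z / (1 + (x - \<alpha> * z)\<^sup>2 / (\<sigma>\<^sup>2 * z)))"
  shows "integral {0..t} F \<le> K * \<sigma> * pi / sqrt \<alpha> * x powr (- (1/2))"
proof -
  \<comment> \<open>the antiderivative, extended continuously to \<open>z = 0\<close>\<close>
  define A where "A = (\<lambda>z. if z = 0 then - (pi / 2) else arctan ((\<alpha> * z - x) / (\<sigma> * sqrt z)))"
  define r where "r = (\<lambda>z. (x + \<alpha> * z) / (2 * \<sigma> * z * sqrt z) / (1 + (x - \<alpha> * z)\<^sup>2 / (\<sigma>\<^sup>2 * z)))"
  have r_int: "(r has_integral (A t - A 0)) {0..t}"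
  proof (rule fundamental_theorem_of_calculus_interior)
    have deriv: "(A has_real_derivative r z) (at z)" if "z > 0" for z
      unfolding r_def
      by (rule has_field_derivative_transform_within_open[OF passage_arctan_deriv[OF that \<sigma>], of "{0<..}"])
        (use that in \<open>auto simp: A_def\<close>)
    show "continuous_on {0..t} A"
      unfolding continuous_on_def
    proof
      fix z assume z: "z \<in> {0..t}"
      show "(A \<longlongrightarrow> A z) (at z within {0..t})"
      proof (cases "z = 0")
        case True
        have "(A \<longlongrightarrow> - (pi / 2)) (at_right 0)"
          by (rule Lim_transform_eventually[OF passage_arctan_limit[OF x \<alpha> \<sigma>]])
            (auto simp: A_def eventually_at_filter)
        then show ?thesis using True t by (simp add: A_def at_within_Icc_at_right)
      next
        case False
        then have "isCont A z" using z deriv[of z] by (intro DERIV_isCont) auto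
        then show ?thesis by (auto simp: isCont_def intro: tendsto_within_subset)
      qed
    qed
    show "(A has_vector_derivative r z) (at z)" if "z \<in> {0<..<t}" for z
      using deriv that by (simp add: has_real_derivative_iff_has_vector_derivative)
  qed (use t in auto)
  have "integral {0..t} F \<le> K * (\<sigma> / sqrt (\<alpha> * x)) * (A t - A 0)"
  proof (rule has_integral_le)
    show "(F has_integral integral {0..t} F) {0..t}"
      using F by (intro integrable_integral integrable_continuous_real)
    show "((\<lambda>z. K * (\<sigma> / sqrt (\<alpha> * x)) * r z) has_integral K * (\<sigma> / sqrt (\<alpha> * x)) * (A t - A 0)) {0..t}"
      by (rule has_integral_mult_right[OF r_int])
    fix z assume z: "z \<in> {0..t}"
    show "F z \<le> K * (\<sigma> / sqrt (\<alpha> * x)) * r z"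
    proof (cases "z = 0")
      case True then show ?thesis using F(2) by (simp add: r_def)
    next
      case False
      then have z: "z > 0" using z by simp
      define D where "D = 1 + (x - \<alpha> * z)\<^sup>2 / (\<sigma>\<^sup>2 * z)"
      have D: "D > 0" unfolding D_def using z \<sigma> by (intro add_pos_nonneg) auto
      have "2 * (sqrt (\<alpha> * x) * sqrt z) \<le> x + \<alpha> * z"
        using arith_geo_mean_sqrt[of x "\<alpha> * z"] x \<alpha> z by (simp add: real_sqrt_mult algebra_simps)
      then have "1 \<le> (x + \<alpha> * z) / (2 * (sqrt (\<alpha> * x) * sqrt z))"
        using x \<alpha> z by (simp add: field_simps)
      then have "1 / z * 1 \<le> 1 / z * ((x + \<alpha> * z) / (2 * (sqrt (\<alpha> * x) * sqrt z)))"
        using z by (intro mult_left_mono) auto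
      also have "\<dots> = \<sigma> / sqrt (\<alpha> * x) * ((x + \<alpha> * z) / (2 * \<sigma> * z * sqrt z))"
        using \<sigma> by simp
      finally have "K * (1 / z / D) \<le> K * ((\<sigma> / sqrt (\<alpha> * x) * ((x + \<alpha> * z) / (2 * \<sigma> * z * sqrt z))) / D)"
        using D K by (intro mult_left_mono divide_right_mono) auto
      also have "\<dots> = K * (\<sigma> / sqrt (\<alpha> * x)) * r z"
      proof -
        have "K * ((a * b) / D) = K * a * (b / D)" for a b by simp
        then show ?thesis unfolding r_def D_def .
      qed
      finally show ?thesis using bound[OF z] unfolding D_def by (rule order_trans[rotated])
    qed
  qed
  also have "A t - A 0 \<le> pi"
    using arctan_ubound[of "(\<alpha> * t - x) / (\<sigma> * sqrt t)"] t by (simp add: A_def)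
  then have "K * (\<sigma> / sqrt (\<alpha> * x)) * (A t - A 0) \<le> K * (\<sigma> / sqrt (\<alpha> * x)) * pi"
    using K \<sigma> x \<alpha> by (intro mult_left_mono) auto
  also have "\<dots> = K * \<sigma> * pi / sqrt \<alpha> * x powr (- (1/2))"
    using x by (simp add: real_sqrt_mult powr_minus powr_half_sqrt field_simps)
  finally show ?thesis .
qed

lemma damped_square:
  "z > 0 \<Longrightarrow> (damped \<alpha> m x z)\<^sup>2 = z powr (- (2 * m)) * exp (- ((x - \<alpha> * z)\<^sup>2 / ((conga_sigma \<alpha>)\<^sup>2 * z)))"
  unfolding damped_def power_mult_distrib
  by (simp add: power2_eq_square[of "_ powr _"] powr_add[symmetric] exp_double[symmetric])

lemma mass_dx_square_integral:
  assumes \<alpha>: "0 < \<alpha>" and \<sigma>: "conga_sigma \<alpha> > 0" and x: "x > 0" and t: "t > 0"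
  shows "integral {0..t} (\<lambda>z. (mass_dx \<alpha> x z)\<^sup>2)
     \<le> (4 * (kappa \<alpha>)\<^sup>2) * conga_sigma \<alpha> * pi / sqrt \<alpha> * x powr (- (1/2))"
proof (rule integral_passage_bound[OF x \<alpha> \<sigma> t])
  show "continuous_on {0..t} (\<lambda>z. (mass_dx \<alpha> x z)\<^sup>2)"
    by (intro continuous_intros continuous_on_section[OF kernels_continuous(4)[OF \<alpha> \<sigma>] x])
  fix z :: real assume z: "z > 0"
  have "(mass_dx \<alpha> x z)\<^sup>2 = 4 * (kappa \<alpha>)\<^sup>2 * (1 / z * exp (- ((x - \<alpha> * z)\<^sup>2 / ((conga_sigma \<alpha>)\<^sup>2 * z))))"
  proof -
    have "z powr (- (2 * (1/2))) = 1 / z" using z by (simp add: powr_minus_divide)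
    then show ?thesis unfolding mass_dx_def power_mult_distrib damped_square[OF z] by simp
  qed
  also have "\<dots> \<le> 4 * (kappa \<alpha>)\<^sup>2 * (1 / z * (1 / (1 + (x - \<alpha> * z)\<^sup>2 / ((conga_sigma \<alpha>)\<^sup>2 * z))))"
    using z \<sigma> by (intro mult_left_mono exp_minus_bounds) auto
  finally show "(mass_dx \<alpha> x z)\<^sup>2 \<le> 4 * (kappa \<alpha>)\<^sup>2 * (1 / z / (1 + (x - \<alpha> * z)\<^sup>2 / ((conga_sigma \<alpha>)\<^sup>2 * z)))"
    by simp
qed auto

text \<open>The square of the second derivative has, up to a constant, a further factor \<open>q / z\<close>, where \<open>q = (x - \<alpha> z)\<^sup>2 / (\<sigma>\<^sup>2 z)\<close>. For
  \<open>z \<ge> x / (2 \<alpha>)\<close> the factor \<open>1 / z\<close> is at most \<open>2 \<alpha> / x\<close>. For smaller \<open>z\<close> it is at most \<open>4 \<sigma>\<^sup>2 q / x\<^sup>2\<close>, and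
  the extra power of \<open>q\<close> is absorbed by the exponential.\<close>

lemma mass_dxx_square_integral:
  assumes \<alpha>: "0 < \<alpha>" and \<sigma>: "conga_sigma \<alpha> > 0" and x: "x > 0" and t: "t > 0"
  shows "integral {0..t} (\<lambda>z. (mass_dxx \<alpha> x z)\<^sup>2)
     \<le> (4 * (kappa \<alpha>)\<^sup>2 / (conga_sigma \<alpha>)\<^sup>2 * (4 * \<alpha> / x + 24 * (conga_sigma \<alpha>)\<^sup>2 / x\<^sup>2))
        * conga_sigma \<alpha> * pi / sqrt \<alpha> * x powr (- (1/2))"
proof (rule integral_passage_bound[OF x \<alpha> \<sigma> t])
  define s where "s = (conga_sigma \<alpha>)\<^sup>2"
  have s: "s > 0" using \<sigma> by (simp add: s_def)
  show "continuous_on {0..t} (\<lambda>z. (mass_dxx \<alpha> x z)\<^sup>2)"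
    by (intro continuous_intros continuous_on_section[OF kernels_continuous(5)[OF \<alpha> \<sigma>] x])
  fix z :: real assume z: "z > 0"
  define q where "q = (x - \<alpha> * z)\<^sup>2 / (s * z)"
  have q: "q \<ge> 0" using s z by (simp add: q_def)
  have "(mass_dxx \<alpha> x z)\<^sup>2 = 4 * (kappa \<alpha>)\<^sup>2 * ((x - \<alpha> * z)\<^sup>2 / s\<^sup>2) * (1 / z ^ 3 * exp (- q))"
  proof -
    have "z powr (- (2 * (3/2))) = 1 / z ^ 3" using z by (simp add: powr_minus_divide powr_numeral)
    then show ?thesis
      unfolding mass_dxx_def power_mult_distrib power_divide damped_square[OF z] q_def s_def by simp
  qed
  also have "(x - \<alpha> * z)\<^sup>2 = q * (s * z)" using s z by (simp add: q_def)
  finally have eq: "(mass_dxx \<alpha> x z)\<^sup>2 = 4 * (kappa \<alpha>)\<^sup>2 / s * (1 / z * (q * exp (- q) / z))"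
    using s z by (simp add: field_simps power2_eq_square power3_eq_cube)
  have "q * exp (- q) / z \<le> (4 * \<alpha> / x + 24 * s / x\<^sup>2) * (1 / (1 + q))"
  proof (cases "2 * \<alpha> * z \<ge> x")
    case True
    then have "1 / z \<le> 2 * \<alpha> / x" using z x by (simp add: field_simps)
    then have "(q * exp (- q)) * (1 / z) \<le> (2 / (1 + q)) * (2 * \<alpha> / x)"
      using q z by (intro mult_mono exp_minus_bounds) auto
    also have "\<dots> = 4 * \<alpha> / x * (1 / (1 + q))" by simp
    also have "\<dots> \<le> (4 * \<alpha> / x + 24 * s / x\<^sup>2) * (1 / (1 + q))"
      using q s by (intro mult_right_mono) auto
    finally show ?thesis by simp
  next
    case False
    then have "x / 2 \<le> x - \<alpha> * z" by simp
    then have "(x / 2)\<^sup>2 \<le> (x - \<alpha> * z)\<^sup>2" using x by (intro power_mono) auto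
    then have "1 / z \<le> 4 * s / x\<^sup>2 * q"
      using x s z by (simp add: q_def power_divide field_simps)
    then have "(q * exp (- q)) * (1 / z) \<le> (q * exp (- q)) * (4 * s / x\<^sup>2 * q)"
      using q by (intro mult_left_mono) auto
    also have "\<dots> = 4 * s / x\<^sup>2 * (q\<^sup>2 * exp (- q))" by (simp add: power2_eq_square)
    also have "\<dots> \<le> 4 * s / x\<^sup>2 * (6 / (1 + q))"
      using q s by (intro mult_left_mono exp_minus_bounds) auto
    also have "\<dots> = 24 * s / x\<^sup>2 * (1 / (1 + q))" by simp
    also have "\<dots> \<le> (4 * \<alpha> / x + 24 * s / x\<^sup>2) * (1 / (1 + q))"
      using q x \<alpha> by (intro mult_right_mono) auto
    finally show ?thesis by simp
  qed
  then have "4 * (kappa \<alpha>)\<^sup>2 / s * (1 / z * (q * exp (- q) / z))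
      \<le> 4 * (kappa \<alpha>)\<^sup>2 / s * (1 / z * ((4 * \<alpha> / x + 24 * s / x\<^sup>2) * (1 / (1 + q))))"
    using s z by (intro mult_left_mono) auto
  then show "(mass_dxx \<alpha> x z)\<^sup>2 \<le> 4 * (kappa \<alpha>)\<^sup>2 / (conga_sigma \<alpha>)\<^sup>2 * (4 * \<alpha> / x + 24 * (conga_sigma \<alpha>)\<^sup>2 / x\<^sup>2)
      * (1 / z / (1 + (x - \<alpha> * z)\<^sup>2 / ((conga_sigma \<alpha>)\<^sup>2 * z)))"
    unfolding eq by (simp add: s_def q_def)
qed (use x \<alpha> in auto)

section \<open>Differentiating the Conga line\<close>

lemma conga_eq_integral:
  assumes \<alpha>: "0 < \<alpha>" and \<sigma>: "conga_sigma \<alpha> > 0" and x: "x > 0" and w: "continuous_on {0..t} (\<lambda>z. w (t - z))"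
  shows "conga \<alpha> w x t = integral {0..t} (\<lambda>z. conga_kernel \<alpha> x z *\<^sub>R w (t - z))"
proof -
  have "set_integrable lborel {0..t} (\<lambda>z. conga_kernel \<alpha> x z *\<^sub>R w (t - z))"
    by (intro borel_integrable_atLeastAtMost' continuous_intros w
        continuous_on_section[OF kernels_continuous(1)[OF \<alpha> \<sigma>] x])
  then have "set_integrable lborel {0<..<t} (\<lambda>z. conga_kernel \<alpha> x z *\<^sub>R w (t - z))"
    by (rule set_integrable_subset) auto
  then show ?thesis
    unfolding conga_def
    by (simp add: set_borel_integral_eq_integral integral_open_interval_real)
qed

text \<open>The integrand is jointly continuous up to \<open>z = 0\<close>, so Leibniz's rule on the compact interval applies.\<close>

lemma kernel_integral_deriv:
  fixes w :: "real \<Rightarrow> real ^ 2"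
  assumes deriv: "\<And>x z. x > 0 \<Longrightarrow> z \<ge> 0 \<Longrightarrow> ((\<lambda>x. F x z) has_real_derivative F' x z) (at x)"
    and F: "continuous_on ({0<..} \<times> {0..}) (\<lambda>(x, z). F x z)"
    and F': "continuous_on ({0<..} \<times> {0..}) (\<lambda>(x, z). F' x z)"
    and w: "continuous_on {0..t} (\<lambda>z. w (t - z))" and x: "x > 0"
  shows "((\<lambda>x. integral {0..t} (\<lambda>z. F x z *\<^sub>R w (t - z))) has_vector_derivative
            integral {0..t} (\<lambda>z. F' x z *\<^sub>R w (t - z))) (at x)"
proof -
  have "((\<lambda>x. integral (cbox 0 t) (\<lambda>z. F x z *\<^sub>R w (t - z))) has_vector_derivative
            integral (cbox 0 t) (\<lambda>z. F' x z *\<^sub>R w (t - z))) (at x within {0<..})"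
  proof (rule leibniz_rule_vector_derivative)
    fix y z :: real assume "y \<in> {0<..}" "z \<in> cbox 0 t"
    then show "((\<lambda>y. F y z *\<^sub>R w (t - z)) has_vector_derivative F' y z *\<^sub>R w (t - z)) (at y within {0<..})"
      using has_vector_derivative_scaleR[OF has_field_derivative_at_within[OF deriv[of y z]] has_vector_derivative_const]
      by simp
  next
    fix y :: real assume "y \<in> {0<..}"
    then show "(\<lambda>z. F y z *\<^sub>R w (t - z)) integrable_on cbox 0 t"
      using continuous_on_section[OF F, of y t] w
      by (auto intro!: integrable_continuous_real continuous_intros)
  next
    have *: "continuous_on ({0<..} \<times> cbox 0 t) (\<lambda>p. (\<lambda>(x, z). F' x z) p)"
      by (rule continuous_on_subset[OF F']) auto
    have "continuous_on ({0<..} \<times> cbox 0 t) (\<lambda>p. w (t - snd p))"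
      by (rule continuous_on_compose2[OF w]) (auto intro!: continuous_intros)
    with * show "continuous_on ({0<..} \<times> cbox 0 t) (\<lambda>(y, z). F' y z *\<^sub>R w (t - z))"
      unfolding case_prod_unfold by (rule continuous_on_scaleR)
  qed (use x in \<open>auto simp: convex_real_interval\<close>)
  then show ?thesis
    using x by (simp add: at_within_open[of x "{0<..}"])
qed

lemma conga_deriv:
  assumes \<alpha>: "0 < \<alpha>" and \<sigma>: "conga_sigma \<alpha> > 0" and x: "x > 0" and w: "continuous_on {0..t} (\<lambda>z. w (t - z))"
  shows "((\<lambda>x. conga \<alpha> w x t) has_vector_derivative integral {0..t} (\<lambda>z. kernel_dx \<alpha> x z *\<^sub>R w (t - z))) (at x)"
    and "((\<lambda>x. conga_dx \<alpha> w x t) has_vector_derivative integral {0..t} (\<lambda>z. kernel_dxx \<alpha> x z *\<^sub>R w (t - z))) (at x)"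
    and "conga_dx \<alpha> w x t = integral {0..t} (\<lambda>z. kernel_dx \<alpha> x z *\<^sub>R w (t - z))"
proof -
  have 1: "((\<lambda>x. conga \<alpha> w x t) has_vector_derivative integral {0..t} (\<lambda>z. kernel_dx \<alpha> x z *\<^sub>R w (t - z))) (at x)"
    if "x > 0" for x
    by (rule has_vector_derivative_transform_within_open[OF
          kernel_integral_deriv[OF conga_kernel_deriv_x[OF \<sigma>] kernels_continuous(1,2)[OF \<alpha> \<sigma>] w that], of "{0<..}"])
      (use that conga_eq_integral[OF \<alpha> \<sigma> _ w] in auto)
  have 2: "conga_dx \<alpha> w x t = integral {0..t} (\<lambda>z. kernel_dx \<alpha> x z *\<^sub>R w (t - z))" if "x > 0" for x
    unfolding conga_dx_def using 1[OF that] by (rule vector_derivative_at)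
  show "((\<lambda>x. conga \<alpha> w x t) has_vector_derivative integral {0..t} (\<lambda>z. kernel_dx \<alpha> x z *\<^sub>R w (t - z))) (at x)"
    and "conga_dx \<alpha> w x t = integral {0..t} (\<lambda>z. kernel_dx \<alpha> x z *\<^sub>R w (t - z))"
    using 1 2 x by auto
  show "((\<lambda>x. conga_dx \<alpha> w x t) has_vector_derivative integral {0..t} (\<lambda>z. kernel_dxx \<alpha> x z *\<^sub>R w (t - z))) (at x)"
    by (rule has_vector_derivative_transform_within_open[OF
          kernel_integral_deriv[OF kernel_dx_deriv_x[OF \<sigma>] kernels_continuous(2,3)[OF \<alpha> \<sigma>] w x], of "{0<..}"])
      (use x 2 in auto)
qed

lemma kernel_integral_continuous:
  fixes w :: "real \<Rightarrow> real ^ 2"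
  assumes F: "continuous_on ({0<..} \<times> {0..}) (\<lambda>(x, z). F x z)"
    and w: "continuous_on {0..t} (\<lambda>z. w (t - z))"
  shows "continuous_on {0<..} (\<lambda>x. integral {0..t} (\<lambda>z. F x z *\<^sub>R w (t - z)))"
proof -
  have "continuous_on {0<..} (\<lambda>x. integral (cbox 0 t) (\<lambda>z. F x z *\<^sub>R w (t - z)))"
  proof (rule integral_continuous_on_param)
    have *: "continuous_on ({0<..} \<times> cbox 0 t) (\<lambda>p. (\<lambda>(x, z). F x z) p)"
      by (rule continuous_on_subset[OF F]) auto
    have "continuous_on ({0<..} \<times> cbox 0 t) (\<lambda>p. w (t - snd p))"
      by (rule continuous_on_compose2[OF w]) (auto intro!: continuous_intros)
    with * show "continuous_on ({0<..} \<times> cbox 0 t) (\<lambda>(y, z). F y z *\<^sub>R w (t - z))"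
      unfolding case_prod_unfold by (rule continuous_on_scaleR)
  qed
  then show ?thesis by simp
qed

section \<open>Moments of the increments\<close>

lemma expectation_le_mono:
  "expectation_le M X c \<Longrightarrow> c \<le> d \<Longrightarrow> expectation_le M X d"
  unfolding expectation_le_def by (meson ennreal_leI order_trans)

text \<open>The increment is at most \<open>\<integral> \<parallel>V\<parallel> = \<integral> h (\<parallel>V\<parallel> / h)\<close>, and by the power mean inequality for the measure
  \<open>h(y) dy\<close> its power is at most \<open>(\<integral> h)\<^sup>2\<^sup>p\<^sup>-\<^sup>1 \<integral> h (\<parallel>V\<parallel> / h)\<^sup>2\<^sup>p\<close>. The function \<open>h\<close> thus has to be comparable
  to the size of \<open>V\<close>. The argument is run on Riemann-Stieltjes sums with weights \<open>h\<close>, so that only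
  measurability of \<open>V\<close> at each fixed \<open>y\<close> enters.\<close>

lemma expectation_sup_increment_le:
  fixes D V :: "real \<Rightarrow> 'c \<Rightarrow> 'b::euclidean_space" and h :: "real \<Rightarrow> real"
  assumes ab: "a \<le> b" and p: "p \<ge> 1" and C: "C \<ge> 0"
    and deriv: "\<And>y \<omega>. y \<in> {a..b} \<Longrightarrow> \<omega> \<in> space M \<Longrightarrow> ((\<lambda>y. D y \<omega>) has_vector_derivative V y \<omega>) (at y)"
    and cont: "\<And>\<omega>. \<omega> \<in> space M \<Longrightarrow> continuous_on {a..b} (\<lambda>y. V y \<omega>)"
    and D: "\<And>y. y \<in> {a..b} \<Longrightarrow> D y \<in> borel_measurable M"
    and V: "\<And>y. y \<in> {a..b} \<Longrightarrow> V y \<in> borel_measurable M"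
    and h: "continuous_on {a..b} h" "\<And>y. y \<in> {a..b} \<Longrightarrow> h y > 0"
    and moment: "\<And>y. y \<in> {a..b} \<Longrightarrow> (\<integral>\<^sup>+\<omega>. ennreal (norm (V y \<omega>) ^ (2 * p)) \<partial>M) \<le> ennreal (C * h y ^ (2 * p))"
  shows "expectation_le M (\<lambda>\<omega>. SUP x\<in>{a..b}. ennreal (norm (D x \<omega> - D a \<omega>) ^ (2 * p)))
           (C * (integral {a..b} h) ^ (2 * p))"
  unfolding expectation_le_def
proof
  have Dcont: "continuous_on {a..b} (\<lambda>y. D y \<omega>)" if "\<omega> \<in> space M" for \<omega>
    using deriv[OF _ that]
    by (intro continuous_at_imp_continuous_on ballI has_derivative_continuous)
      (auto simp: has_vector_derivative_def)
  show "(\<lambda>\<omega>. SUP x\<in>{a..b}. ennreal (norm (D x \<omega> - D a \<omega>) ^ (2 * p))) \<in> borel_measurable M"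
    using ab by (intro sup_continuous_measurable continuous_intros Dcont borel_measurable_power
        borel_measurable_norm borel_measurable_diff D measurable_compose[OF _ borel_measurable_norm]) auto
  define z where "z = grid a b"
  define H where "H = (\<lambda>n i. integral {z n i..z n (Suc i)} h)"
  define X where "X = (\<lambda>n \<omega>. (\<Sum>i<n. H n i * (norm (V (z n i) \<omega>) / h (z n i))) ^ (2 * p))"
  define J where "J = (\<lambda>\<omega>. integral {a..b} (\<lambda>y. norm (V y \<omega>)))"
  have zin: "z n i \<in> {a..b}" if "i \<le> n" "n > 0" for n i
    using grid_in[OF ab that(2,1)] by (simp add: z_def)
  have zmono: "z n i \<le> z n (Suc i)" for n i
    by (simp add: z_def grid_mono ab)
  have H0: "H n i \<ge> 0" if "i < n" for n i
  proof -
    have sub: "{z n i..z n (Suc i)} \<subseteq> {a..b}" using zin[of i n] zin[of "Suc i" n] that by auto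
    then show ?thesis
      unfolding H_def using h(2)
      by (intro integral_nonneg integrable_continuous_real continuous_on_subset[OF h(1)])
        (auto intro: less_imp_le)
  qed
  have Hsum: "(\<Sum>i<n. H n i) = integral {a..b} h" if "n > 0" for n
    unfolding H_def z_def using integral_sum_grid[OF ab that integrable_continuous_real[OF h(1)]] by simp
  have "(\<integral>\<^sup>+\<omega>. (SUP x\<in>{a..b}. ennreal (norm (D x \<omega> - D a \<omega>) ^ (2 * p))) \<partial>M)
      \<le> (\<integral>\<^sup>+\<omega>. ennreal (J \<omega> ^ (2 * p)) \<partial>M)"
  proof (intro nn_integral_mono SUP_least ennreal_leI power_mono norm_ge_zero)
    fix \<omega> x assume \<omega>: "\<omega> \<in> space M" and x: "x \<in> {a..b}"
    have sub: "{a..x} \<subseteq> {a..b}" using x by auto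
    have nV: "(\<lambda>y. norm (V y \<omega>)) integrable_on {a..b}" "(\<lambda>y. norm (V y \<omega>)) integrable_on {a..x}"
      by (rule integrable_continuous_real continuous_on_norm cont[OF \<omega>] continuous_on_subset[OF cont[OF \<omega>] sub])+
    have "((\<lambda>y. V y \<omega>) has_integral (D x \<omega> - D a \<omega>)) {a..x}"
    proof (rule fundamental_theorem_of_calculus)
      show "((\<lambda>y. D y \<omega>) has_vector_derivative V y \<omega>) (at y within {a..x})" if "y \<in> {a..x}" for y
        by (rule has_vector_derivative_at_within[OF deriv[OF _ \<omega>]]) (use that sub in auto)
    qed (use x in auto)
    then have "norm (D x \<omega> - D a \<omega>) = norm (integral {a..x} (\<lambda>y. V y \<omega>))"
      by (simp add: integral_unique)
    also have "\<dots> \<le> integral {a..x} (\<lambda>y. norm (V y \<omega>))"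
      using continuous_on_subset[OF cont[OF \<omega>] sub]
      by (intro integral_norm_bound_integral nV integrable_continuous_real) auto
    also have "\<dots> \<le> J \<omega>"
      unfolding J_def using nV sub by (intro integral_subset_le) auto
    finally show "norm (D x \<omega> - D a \<omega>) \<le> J \<omega>" .
  qed
  also have "\<dots> \<le> ennreal (C * (integral {a..b} h) ^ (2 * p))"
  proof (rule nn_integral_tendsto_le[where X = X])
    have V': "V (z n i) \<in> borel_measurable M" if "i < n" for n i
      using V zin[of i n] that by auto
    show "X n \<in> borel_measurable M" for n
      unfolding X_def
      by (intro borel_measurable_power borel_measurable_sum borel_measurable_times borel_measurable_divide
          measurable_compose[OF V' borel_measurable_norm] borel_measurable_const) auto
    show "(\<lambda>n. X n \<omega>) \<longlonglongrightarrow> J \<omega> ^ (2 * p)" if \<omega>: "\<omega> \<in> space M" for \<omega>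
    proof -
      have "(\<lambda>n. \<Sum>i<n. H n i *\<^sub>R (norm (V (z n i) \<omega>) / h (z n i)))
          \<longlonglongrightarrow> integral {a..b} (\<lambda>y. h y *\<^sub>R (norm (V y \<omega>) / h y))"
        unfolding H_def z_def using h grid_mono[OF ab]
        by (intro stieltjes_sums_tendsto ab continuous_intros cont \<omega>) (auto simp: less_le)
      also have "integral {a..b} (\<lambda>y. h y *\<^sub>R (norm (V y \<omega>) / h y)) = J \<omega>"
        unfolding J_def using h(2) by (intro integral_cong) (auto simp: less_le)
      finally show ?thesis unfolding X_def by (intro tendsto_power) simp
    qed
    show "(\<integral>\<^sup>+\<omega>. ennreal (X n \<omega>) \<partial>M) \<le> ennreal (C * (integral {a..b} h) ^ (2 * p))" if n: "n > 0" for n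
    proof -
      define S where "S = integral {a..b} h"
      have S: "S \<ge> 0" using Hsum[OF n] H0 by (metis S_def lessThan_iff sum_nonneg)
      define k where "k = (\<lambda>i. S ^ (2 * p - 1) * H n i / h (z n i) ^ (2 * p))"
      have hz: "h (z n i) > 0" if "i < n" for i using h(2) zin[of i n] that by auto
      have k: "k i \<ge> 0" if "i < n" for i
        unfolding k_def using S H0[OF that] hz[OF that] by (intro divide_nonneg_nonneg mult_nonneg_nonneg) auto
      have "(\<integral>\<^sup>+\<omega>. ennreal (X n \<omega>) \<partial>M) \<le> (\<integral>\<^sup>+\<omega>. (\<Sum>i<n. ennreal (k i) * ennreal (norm (V (z n i) \<omega>) ^ (2 * p))) \<partial>M)"
      proof (rule nn_integral_mono)
        fix \<omega>
        have "X n \<omega> \<le> S ^ (2 * p - 1) * (\<Sum>i<n. H n i * (norm (V (z n i) \<omega>) / h (z n i)) ^ (2 * p))"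
          unfolding X_def S_def Hsum[OF n, symmetric] by (rule weighted_power_mean[OF H0 p])
        also have "\<dots> = (\<Sum>i<n. k i * norm (V (z n i) \<omega>) ^ (2 * p))"
          by (simp add: k_def sum_distrib_left power_divide mult.assoc)
        finally have "ennreal (X n \<omega>) \<le> ennreal (\<Sum>i<n. k i * norm (V (z n i) \<omega>) ^ (2 * p))"
          by (rule ennreal_leI)
        also have "\<dots> = (\<Sum>i<n. ennreal (k i * norm (V (z n i) \<omega>) ^ (2 * p)))"
          using k by (intro sum_ennreal[symmetric]) auto
        also have "\<dots> = (\<Sum>i<n. ennreal (k i) * ennreal (norm (V (z n i) \<omega>) ^ (2 * p)))"
          using k by (intro sum.cong refl ennreal_mult') auto
        finally show "ennreal (X n \<omega>) \<le> \<dots>" .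
      qed
      also have "\<dots> = (\<Sum>i<n. ennreal (k i) * (\<integral>\<^sup>+\<omega>. ennreal (norm (V (z n i) \<omega>) ^ (2 * p)) \<partial>M))"
      proof -
        have m: "(\<lambda>\<omega>. ennreal (norm (V (z n i) \<omega>) ^ (2 * p))) \<in> borel_measurable M" if "i < n" for i
          by (intro measurable_compose[OF _ measurable_ennreal] borel_measurable_power
              measurable_compose[OF V'[OF that] borel_measurable_norm])
        show ?thesis
          by (subst nn_integral_sum, intro borel_measurable_times_ennreal m borel_measurable_const, simp)
            (intro sum.cong refl nn_integral_cmult m, simp)
      qed
      also have "\<dots> \<le> (\<Sum>i<n. ennreal (k i) * ennreal (C * h (z n i) ^ (2 * p)))"
        using zin n by (intro sum_mono mult_left_mono moment) auto
      also have "\<dots> = (\<Sum>i<n. ennreal (C * S ^ (2 * p - 1) * H n i))"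
      proof (rule sum.cong[OF refl])
        fix i assume "i \<in> {..<n}"
        then have "k i * (C * h (z n i) ^ (2 * p)) = C * S ^ (2 * p - 1) * H n i" "k i \<ge> 0"
          using hz[of i] k[of i] by (auto simp: k_def)
        then show "ennreal (k i) * ennreal (C * h (z n i) ^ (2 * p)) = ennreal (C * S ^ (2 * p - 1) * H n i)"
          by (metis ennreal_mult')
      qed
      also have "\<dots> = ennreal (C * S ^ (2 * p - 1) * (\<Sum>i<n. H n i))"
        unfolding sum_distrib_left using C S H0 by (intro sum_ennreal) auto
      also have "C * S ^ (2 * p - 1) * (\<Sum>i<n. H n i) = C * S ^ (2 * p)"
        using p by (simp add: Hsum[OF n] S_def[symmetric] power_eq_if)
      finally show ?thesis by (simp add: S_def)
    qed
  qed simp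
  finally show "(\<integral>\<^sup>+\<omega>. (SUP x\<in>{a..b}. ennreal (norm (D x \<omega> - D a \<omega>) ^ (2 * p))) \<partial>M)
    \<le> ennreal (C * (integral {a..b} h) ^ (2 * p))" .
qed

context std_planar_brownian_motion
begin

lemma conga_measurable:
  assumes \<alpha>: "0 < \<alpha>" and \<sigma>: "conga_sigma \<alpha> > 0" and t: "t > 0" and y: "y > 0"
  shows "(\<lambda>\<omega>. conga \<alpha> (\<lambda>s. W s \<omega>) y t) \<in> borel_measurable M"
    and "(\<lambda>\<omega>. conga_dx \<alpha> (\<lambda>s. W s \<omega>) y t) \<in> borel_measurable M"
    and "(\<lambda>\<omega>. integral {0..t} (\<lambda>z. kernel_dx \<alpha> y z *\<^sub>R W (t - z) \<omega>)) \<in> borel_measurable M"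
    and "(\<lambda>\<omega>. integral {0..t} (\<lambda>z. kernel_dxx \<alpha> y z *\<^sub>R W (t - z) \<omega>)) \<in> borel_measurable M"
proof -
  note meas = reversed_path_integral_measurable[OF less_imp_le[OF t] continuous_on_section[OF _ y]]
  note kc = kernels_continuous[OF \<alpha> \<sigma>]
  show 1: "(\<lambda>\<omega>. integral {0..t} (\<lambda>z. kernel_dx \<alpha> y z *\<^sub>R W (t - z) \<omega>)) \<in> borel_measurable M"
    and "(\<lambda>\<omega>. integral {0..t} (\<lambda>z. kernel_dxx \<alpha> y z *\<^sub>R W (t - z) \<omega>)) \<in> borel_measurable M"
    by (intro meas kc)+
  show "(\<lambda>\<omega>. conga \<alpha> (\<lambda>s. W s \<omega>) y t) \<in> borel_measurable M"
    using meas[OF kc(1)]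
    by (subst measurable_cong[OF conga_eq_integral[OF \<alpha> \<sigma> y reversed_path_continuous]])
  show "(\<lambda>\<omega>. conga_dx \<alpha> (\<lambda>s. W s \<omega>) y t) \<in> borel_measurable M"
    using 1 by (subst measurable_cong[OF conga_deriv(3)[OF \<alpha> \<sigma> y reversed_path_continuous]])
qed

text \<open>On \<open>{k..k + 1}\<close> the bound of order \<open>y\<^sup>-\<^sup>1\<^sup>/\<^sup>2\<close> on the variance of the derivative is at most one of order \<open>k\<^sup>-\<^sup>1\<^sup>/\<^sup>2\<close>, so the weight can be the constant
  \<open>k\<^sup>-\<^sup>1\<^sup>/\<^sup>4\<close>.\<close>

lemma conga_increment_moment:
  assumes \<alpha>: "0 < \<alpha>" and \<sigma>: "conga_sigma \<alpha> > 0" and t: "t > 0" and k: "k > 0" and p: "p \<ge> 1"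
  shows "expectation_le M
     (\<lambda>\<omega>. SUP x\<in>{k..k + 1}. ennreal (norm (conga \<alpha> (\<lambda>s. W s \<omega>) x t - conga \<alpha> (\<lambda>s. W s \<omega>) k t) ^ (2 * p)))
     (planar_moment p * ((4 * (kappa \<alpha>)\<^sup>2) * conga_sigma \<alpha> * pi / sqrt \<alpha>) ^ p
        * k powr (- (real p / 2)))"
proof -
  define A where "A = (4 * (kappa \<alpha>)\<^sup>2) * conga_sigma \<alpha> * pi / sqrt \<alpha>"
  have A: "A \<ge> 0" using \<alpha> \<sigma> by (simp add: A_def)
  define m where "m = planar_moment p"
  have m: "m \<ge> 0" unfolding m_def by (rule planar_moment_nonneg)
  define h where "h = k powr (- (1/4))"
  have h: "h > 0" using k by (simp add: h_def)
  have h2: "h\<^sup>2 = k powr (- (1/2))" by (simp add: h_def power2_eq_square powr_add[symmetric])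
  have h2p: "h ^ (2 * p) = k powr (- (real p / 2))"
    unfolding h_def using k by (simp add: powr_realpow[symmetric] powr_powr)
  have "expectation_le M
     (\<lambda>\<omega>. SUP x\<in>{k..k + 1}. ennreal (norm (conga \<alpha> (\<lambda>s. W s \<omega>) x t - conga \<alpha> (\<lambda>s. W s \<omega>) k t) ^ (2 * p)))
     (m * A ^ p * (integral {k..k + 1} (\<lambda>_. h)) ^ (2 * p))"
  proof (rule expectation_sup_increment_le)
    show "((\<lambda>y. conga \<alpha> (\<lambda>s. W s \<omega>) y t) has_vector_derivative
        integral {0..t} (\<lambda>z. kernel_dx \<alpha> y z *\<^sub>R W (t - z) \<omega>)) (at y)"
      if "y \<in> {k..k + 1}" "\<omega> \<in> space M" for y \<omega>
      using that k by (intro conga_deriv(1) \<alpha> \<sigma> reversed_path_continuous) auto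
    show "continuous_on {k..k + 1} (\<lambda>y. integral {0..t} (\<lambda>z. kernel_dx \<alpha> y z *\<^sub>R W (t - z) \<omega>))"
      if "\<omega> \<in> space M" for \<omega>
      by (rule continuous_on_subset[OF kernel_integral_continuous[OF kernels_continuous(2)[OF \<alpha> \<sigma>] reversed_path_continuous[OF that]]])
        (use k in auto)
    fix y assume y: "y \<in> {k..k + 1}"
    then have y0: "y > 0" using k by auto
    show "(\<lambda>\<omega>. conga \<alpha> (\<lambda>s. W s \<omega>) y t) \<in> borel_measurable M"
      "(\<lambda>\<omega>. integral {0..t} (\<lambda>z. kernel_dx \<alpha> y z *\<^sub>R W (t - z) \<omega>)) \<in> borel_measurable M"
      by (intro conga_measurable \<alpha> \<sigma> t y0)+
    have "integral {0..t} (\<lambda>z. (mass_dx \<alpha> y z)\<^sup>2) \<le> A * y powr (- (1/2))"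
      unfolding A_def by (rule mass_dx_square_integral[OF \<alpha> \<sigma> y0 t])
    also have "\<dots> \<le> A * h\<^sup>2"
      unfolding h2 using y k A by (intro mult_left_mono powr_mono2') auto
    finally have le: "integral {0..t} (\<lambda>z. (mass_dx \<alpha> y z)\<^sup>2) \<le> A * h\<^sup>2" .
    show "(\<integral>\<^sup>+\<omega>. ennreal (norm (integral {0..t} (\<lambda>z. kernel_dx \<alpha> y z *\<^sub>R W (t - z) \<omega>)) ^ (2 * p)) \<partial>M)
        \<le> ennreal (m * A ^ p * h ^ (2 * p))"
      using reversed_path_integral_moment_le[OF t p
          continuous_on_section[OF kernels_continuous(2)[OF \<alpha> \<sigma>] y0]
          continuous_on_section[OF kernels_continuous(4)[OF \<alpha> \<sigma>] y0]
          mass_at_0(1) mass_dx_deriv_z[OF \<sigma>] le] unfolding m_def[symmetric]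
      by (simp add: power_mult_distrib power_mult mult.assoc)
  qed (use A m p h in auto)
  then show ?thesis using k by (simp add: m_def A_def h2p)
qed

text \<open>The variance of the second derivative is at most of order \<open>(1 + 1/y) y\<^sup>-\<^sup>3\<^sup>/\<^sup>2\<close>. The factor \<open>1 + 1/y\<close> matters for small
  \<open>y\<close>: bounding it by \<open>1 + 1/k\<close> would lose a power of \<open>k\<close> as \<open>k\<close> tends to \<open>0\<close>. The integrable weight
  \<open>1 + y\<^sup>-\<^sup>1\<^sup>/\<^sup>2\<close> has a square that dominates it, and only \<open>y\<^sup>-\<^sup>3\<^sup>/\<^sup>2\<close> is replaced by its value at \<open>k\<close>.\<close>

lemma conga_dx_increment_moment:
  assumes \<alpha>: "0 < \<alpha>" and \<sigma>: "conga_sigma \<alpha> > 0" and t: "t > 0" and k: "k > 0" and p: "p \<ge> 1"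
  shows "expectation_le M
     (\<lambda>\<omega>. SUP x\<in>{k..k + 1}. ennreal (norm (conga_dx \<alpha> (\<lambda>s. W s \<omega>) x t - conga_dx \<alpha> (\<lambda>s. W s \<omega>) k t) ^ (2 * p)))
     (planar_moment p
        * (4 * (kappa \<alpha>)\<^sup>2 / (conga_sigma \<alpha>)\<^sup>2 * (4 * \<alpha> + 24 * (conga_sigma \<alpha>)\<^sup>2) * conga_sigma \<alpha> * pi / sqrt \<alpha>) ^ p
        * 9 ^ p * k powr (- (3 * real p / 2)))"
proof -
  define A where "A = 4 * (kappa \<alpha>)\<^sup>2 / (conga_sigma \<alpha>)\<^sup>2 * (4 * \<alpha> + 24 * (conga_sigma \<alpha>)\<^sup>2) * conga_sigma \<alpha> * pi / sqrt \<alpha>"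
  have A: "A \<ge> 0" using \<alpha> \<sigma> by (simp add: A_def)
  define m where "m = planar_moment p"
  have m: "m \<ge> 0" unfolding m_def by (rule planar_moment_nonneg)
  define c where "c = k powr (- (3/4))"
  have c: "c > 0" using k by (simp add: c_def)
  have c2: "c\<^sup>2 = k powr (- (3/2))" by (simp add: c_def power2_eq_square powr_add[symmetric])
  have c2p: "c ^ (2 * p) = k powr (- (3 * real p / 2))"
    unfolding c_def using k by (simp add: powr_realpow[symmetric] powr_powr)
  define h where "h = (\<lambda>y. c * (1 + y powr (- (1/2))))"
  have hcont: "continuous_on {k..k + 1} h" using k unfolding h_def by (intro continuous_intros) auto
  have sup_le: "expectation_le M
     (\<lambda>\<omega>. SUP x\<in>{k..k + 1}. ennreal (norm (conga_dx \<alpha> (\<lambda>s. W s \<omega>) x t - conga_dx \<alpha> (\<lambda>s. W s \<omega>) k t) ^ (2 * p)))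
     (m * A ^ p * (integral {k..k + 1} h) ^ (2 * p))"
  proof (rule expectation_sup_increment_le)
    show "((\<lambda>y. conga_dx \<alpha> (\<lambda>s. W s \<omega>) y t) has_vector_derivative
        integral {0..t} (\<lambda>z. kernel_dxx \<alpha> y z *\<^sub>R W (t - z) \<omega>)) (at y)"
      if "y \<in> {k..k + 1}" "\<omega> \<in> space M" for y \<omega>
      using that k by (intro conga_deriv(2) \<alpha> \<sigma> reversed_path_continuous) auto
    show "continuous_on {k..k + 1} (\<lambda>y. integral {0..t} (\<lambda>z. kernel_dxx \<alpha> y z *\<^sub>R W (t - z) \<omega>))"
      if "\<omega> \<in> space M" for \<omega>
      by (rule continuous_on_subset[OF kernel_integral_continuous[OF kernels_continuous(3)[OF \<alpha> \<sigma>] reversed_path_continuous[OF that]]])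
        (use k in auto)
    fix y assume y: "y \<in> {k..k + 1}"
    then have y0: "y > 0" using k by auto
    show "(\<lambda>\<omega>. conga_dx \<alpha> (\<lambda>s. W s \<omega>) y t) \<in> borel_measurable M"
      "(\<lambda>\<omega>. integral {0..t} (\<lambda>z. kernel_dxx \<alpha> y z *\<^sub>R W (t - z) \<omega>)) \<in> borel_measurable M"
      by (intro conga_measurable \<alpha> \<sigma> t y0)+
    show "h y > 0" using c y0 by (simp add: h_def add_pos_pos)
    define s where "s = (conga_sigma \<alpha>)\<^sup>2"
    have s: "s > 0" using \<sigma> by (simp add: s_def)
    \<comment> \<open>the constant \<open>A\<close> without the factor that comes from the bound on \<open>q exp (- q) / z\<close>\<close>
    define L where "L = 4 * (kappa \<alpha>)\<^sup>2 / s * conga_sigma \<alpha> * pi / sqrt \<alpha>"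
    have L: "L \<ge> 0" using \<alpha> \<sigma> s by (simp add: L_def)
    have "integral {0..t} (\<lambda>z. (mass_dxx \<alpha> y z)\<^sup>2) \<le> L * ((4 * \<alpha> / y + 24 * s / y\<^sup>2) * y powr (- (1/2)))"
      using mass_dxx_square_integral[OF \<alpha> \<sigma> y0 t] by (simp add: L_def s_def ac_simps)
    also have "(4 * \<alpha> / y + 24 * s / y\<^sup>2) \<le> (4 * \<alpha> + 24 * s) * ((1 + 1 / y) / y)"
      using y0 \<alpha> s by (simp add: field_simps power2_eq_square)
    then have "L * ((4 * \<alpha> / y + 24 * s / y\<^sup>2) * y powr (- (1/2)))
        \<le> L * ((4 * \<alpha> + 24 * s) * ((1 + 1 / y) / y) * y powr (- (1/2)))"
      using L by (intro mult_left_mono mult_right_mono) auto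
    also have "\<dots> = A * ((1 + 1 / y) * y powr (- (3/2)))"
    proof -
      have "y powr (- (3/2)) = y powr (- (1/2)) / y"
        using y0 powr_diff[of y "- (1/2)" 1] by simp
      then show ?thesis by (simp add: A_def L_def s_def ac_simps)
    qed
    also have "\<dots> \<le> A * (h y)\<^sup>2"
    proof (rule mult_left_mono[OF _ A])
      have "y powr (- (3/2)) \<le> c\<^sup>2" unfolding c2 using y k by (intro powr_mono2') auto
      moreover have "(y powr (- (1/2)))\<^sup>2 = 1 / y"
        using y0 by (simp add: power2_eq_square powr_add[symmetric] powr_minus_divide)
      then have "1 + 1 / y \<le> (1 + y powr (- (1/2)))\<^sup>2"
        by (simp add: power2_sum)
      ultimately have "(1 + 1 / y) * y powr (- (3/2)) \<le> (1 + y powr (- (1/2)))\<^sup>2 * c\<^sup>2"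
        using y0 by (intro mult_mono) auto
      then show "(1 + 1 / y) * y powr (- (3/2)) \<le> (h y)\<^sup>2"
        by (simp add: h_def power_mult_distrib mult.commute)
    qed
    finally have le: "integral {0..t} (\<lambda>z. (mass_dxx \<alpha> y z)\<^sup>2) \<le> A * (h y)\<^sup>2" .
    show "(\<integral>\<^sup>+\<omega>. ennreal (norm (integral {0..t} (\<lambda>z. kernel_dxx \<alpha> y z *\<^sub>R W (t - z) \<omega>)) ^ (2 * p)) \<partial>M)
        \<le> ennreal (m * A ^ p * h y ^ (2 * p))"
      using reversed_path_integral_moment_le[OF t p
          continuous_on_section[OF kernels_continuous(3)[OF \<alpha> \<sigma>] y0]
          continuous_on_section[OF kernels_continuous(5)[OF \<alpha> \<sigma>] y0]
          mass_at_0(2) mass_dxx_deriv_z[OF \<sigma>] le] unfolding m_def[symmetric]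
      by (simp add: power_mult_distrib power_mult mult.assoc)
  qed (use A m p hcont in auto)
  have "integral {k..k + 1} h \<le> 3 * c"
  proof -
    have "((\<lambda>y. c * (1 + y powr (- (1/2)))) has_integral (c * (k + 1 + 2 * sqrt (k + 1)) - c * (k + 2 * sqrt k))) {k..k + 1}"
    proof (rule fundamental_theorem_of_calculus)
      fix y assume "y \<in> {k..k + 1}"
      then have y: "y > 0" using k by auto
      have "((\<lambda>y. c * (y + 2 * sqrt y)) has_real_derivative c * (1 + y powr (- (1/2)))) (at y)"
        using y by (auto intro!: derivative_eq_intros simp: powr_minus powr_half_sqrt)
      then show "((\<lambda>y. c * (y + 2 * sqrt y)) has_vector_derivative c * (1 + y powr (- (1/2)))) (at y within {k..k + 1})"
        by (simp add: has_real_derivative_iff_has_vector_derivative has_vector_derivative_at_within)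
    qed simp
    then have "integral {k..k + 1} h = c * (k + 1 + 2 * sqrt (k + 1)) - c * (k + 2 * sqrt k)"
      unfolding h_def by (rule integral_unique)
    also have "\<dots> = c * (1 + 2 * (sqrt (k + 1) - sqrt k))" by (simp add: algebra_simps)
    also have "\<dots> \<le> c * 3"
      using c sqrt_add_le_add_sqrt[of k 1] k by (intro mult_left_mono) auto
    finally show ?thesis by simp
  qed
  then have "(integral {k..k + 1} h) ^ (2 * p) \<le> (3 * c) ^ (2 * p)"
    using c by (intro power_mono integral_nonneg integrable_continuous_real hcont) (auto simp: h_def)
  then have le: "m * A ^ p * (integral {k..k + 1} h) ^ (2 * p) \<le> m * A ^ p * (3 * c) ^ (2 * p)"
    using m A by (intro mult_left_mono) auto
  have eq: "m * A ^ p * (3 * c) ^ (2 * p) = m * A ^ p * 9 ^ p * k powr (- (3 * real p / 2))"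
    unfolding power_mult_distrib c2p by (simp add: power_mult)
  show ?thesis
    unfolding m_def[symmetric] A_def[symmetric] by (rule expectation_le_mono[OF sup_le le[unfolded eq]])
qed

end

section \<open>Almost sure bounds\<close>

text \<open>By Markov's inequality the bound fails for a given \<open>n\<close> and \<open>k\<close> with probability of order
  \<open>k\<^sup>-\<^sup>2\<^sup>p\<^sup>\<eta>\<close>, which is of order \<open>n\<^sup>-\<^sup>3\<close> because \<open>k \<ge> \<delta> n\<close> and \<open>2 p \<eta> \<ge> 3\<close>. There are at most \<open>n\<close> values of \<open>k\<close>, so the
  Borel-Cantelli lemma applies.\<close>

lemma (in prob_space) AE_eventually_sup_le:
  fixes f :: "nat \<Rightarrow> int \<Rightarrow> real \<Rightarrow> 'a \<Rightarrow> real"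
  assumes \<delta>: "0 < \<delta>" and \<alpha>: "\<alpha> < 1" and \<mu>: "0 < \<mu>" and C: "0 \<le> C" and p: "3 \<le> 2 * real p * \<eta>"
    and f: "\<And>n k x \<omega>. 0 \<le> f n k x \<omega>"
    and moment: "\<And>n k. 1 \<le> n \<Longrightarrow> of_int k \<in> {\<delta> * real n..\<alpha> * real n} \<Longrightarrow>
        expectation_le M (\<lambda>\<omega>. SUP x\<in>{of_int k..of_int k + 1}. ennreal (f n k x \<omega> ^ (2 * p)))
          (C * of_int k powr (- (\<beta> * (2 * real p))))"
  shows "AE \<omega> in M. \<exists>N::nat. N \<ge> 1 \<and> (\<forall>n::nat. n \<ge> N \<longrightarrow>
           (\<forall>k::int. of_int k \<in> {\<delta> * real n..\<alpha> * real n} \<longrightarrow>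
              (SUP x\<in>{of_int k..of_int k + 1}. ennreal (f n k x \<omega>)) \<le> ennreal (\<mu> * of_int k powr (- (\<beta> - \<eta>)))))"
proof -
  have p\<eta>: "0 \<le> \<eta> * real p"
  proof -
    have "2 * real p * \<eta> = 2 * (\<eta> * real p)" by simp
    then show ?thesis using p by linarith
  qed
  define K where "K = (\<lambda>n::nat. {k::int. of_int k \<in> {\<delta> * real n..\<alpha> * real n}})"
  define G where "G = (\<lambda>n (k::int) \<omega>. SUP x\<in>{of_int k..of_int k + 1}. ennreal (f n k x \<omega> ^ (2 * p)))"
  define b where "b = (\<lambda>k::int. \<mu> * of_int k powr (- (\<beta> - \<eta>)))"
  define Bad where "Bad = (\<lambda>n k. {\<omega>\<in>space M. 1 \<le> ennreal (1 / b k ^ (2 * p)) * G n k \<omega>})"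
  have Kpos: "real_of_int k > 0" "real_of_int k \<ge> \<delta> * real n" if "k \<in> K n" "n \<ge> 1" for k n
  proof -
    have "0 < \<delta> * real n" using \<delta> that by simp
    moreover show "real_of_int k \<ge> \<delta> * real n" using that by (simp add: K_def)
    ultimately show "real_of_int k > 0" by linarith
  qed
  have Ksub: "K n \<subseteq> {1..int n}" if "n \<ge> 1" for n
  proof
    fix k assume k: "k \<in> K n"
    have "real_of_int k \<le> \<alpha> * real n" using k by (simp add: K_def)
    also have "\<dots> \<le> 1 * real n" using \<alpha> by (intro mult_right_mono) auto
    finally show "k \<in> {1..int n}" using Kpos(1)[OF k that] by auto
  qed
  have Kfin: "finite (K n)" if "n \<ge> 1" for n
    using Ksub[OF that] by (rule finite_subset) simp
  have Kcard: "card (K n) \<le> n" if "n \<ge> 1" for n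
    using card_mono[OF _ Ksub[OF that]] by simp
  have bpos: "b k > 0" if "k \<in> K n" "n \<ge> 1" for k n
    using Kpos[OF that] \<mu> by (simp add: b_def)
  have G: "G n k \<in> borel_measurable M"
    "(\<integral>\<^sup>+\<omega>. G n k \<omega> \<partial>M) \<le> ennreal (C * of_int k powr (- (\<beta> * (2 * real p))))" if "k \<in> K n" "n \<ge> 1" for n k
    using moment[of n k] that unfolding expectation_le_def G_def K_def by auto
  have Bad_sets: "Bad n k \<in> sets M" if "k \<in> K n" "n \<ge> 1" for n k
    unfolding Bad_def using G(1)[OF that] by measurable
  define c where "c = C / \<mu> ^ (2 * p) * \<delta> powr (- (2 * real p * \<eta>))"
  have c: "c \<ge> 0" using C \<mu> by (simp add: c_def)
  have Bad_prob: "prob (Bad n k) \<le> c / real n ^ 3" if k: "k \<in> K n" and n: "n \<ge> 1" for n k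
  proof -
    let ?k = "real_of_int k"
    have "emeasure M (Bad n k) \<le> ennreal (1 / b k ^ (2 * p)) * (\<integral>\<^sup>+\<omega>. G n k \<omega> * indicator (space M) \<omega> \<partial>M)"
      unfolding Bad_def using G(1)[OF that] by (intro nn_integral_Markov_inequality) auto
    also have "(\<integral>\<^sup>+\<omega>. G n k \<omega> * indicator (space M) \<omega> \<partial>M) = (\<integral>\<^sup>+\<omega>. G n k \<omega> \<partial>M)"
      by (intro nn_integral_cong) simp
    also have "ennreal (1 / b k ^ (2 * p)) * \<dots> \<le> ennreal (1 / b k ^ (2 * p)) * ennreal (C * ?k powr (- (\<beta> * (2 * real p))))"
      by (intro mult_left_mono G(2)[OF that]) auto
    also have "\<dots> = ennreal (1 / b k ^ (2 * p) * (C * ?k powr (- (\<beta> * (2 * real p)))))"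
      using bpos[OF that] by (intro ennreal_mult'[symmetric]) auto
    finally have "prob (Bad n k) \<le> 1 / b k ^ (2 * p) * (C * ?k powr (- (\<beta> * (2 * real p))))"
      unfolding emeasure_eq_measure using C bpos[OF that] by (subst (asm) ennreal_le_iff) auto
    also have "b k ^ (2 * p) = \<mu> ^ (2 * p) * ?k powr (- ((\<beta> - \<eta>) * (2 * real p)))"
      using Kpos[OF that] by (simp add: b_def power_mult_distrib powr_realpow[symmetric] powr_powr algebra_simps)
    also have "1 / (\<mu> ^ (2 * p) * ?k powr (- ((\<beta> - \<eta>) * (2 * real p)))) * (C * ?k powr (- (\<beta> * (2 * real p))))
        = C / \<mu> ^ (2 * p) * ?k powr (- (2 * real p * \<eta>))"
    proof -
      have "?k powr (- (\<beta> * (2 * real p))) / ?k powr (- ((\<beta> - \<eta>) * (2 * real p))) = ?k powr (- (2 * real p * \<eta>))"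
        using Kpos[OF that] by (simp add: powr_diff[symmetric] algebra_simps)
      moreover have "1 / (u * v) * (C * w) = C / u * (w / v)" for u v w :: real by simp
      ultimately show ?thesis by (simp only:)
    qed
    also have "\<dots> \<le> C / \<mu> ^ (2 * p) * (\<delta> * real n) powr (- (2 * real p * \<eta>))"
      using Kpos[OF that] \<delta> n C \<mu> p\<eta> by (intro mult_left_mono powr_mono2') auto
    also have "\<dots> = c * real n powr (- (2 * real p * \<eta>))"
      using \<delta> by (simp add: c_def powr_mult)
    also have "\<dots> \<le> c * real n powr (- 3)"
      using c p n by (intro mult_left_mono powr_mono) auto
    also have "\<dots> = c / real n ^ 3"
      using n by (simp add: powr_minus_divide)
    finally show ?thesis .
  qed
  \<comment> \<open>for \<open>n = 0\<close> the admissible \<open>k\<close> is \<open>0\<close>, for which there is no moment bound\<close>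
  define A where "A = (\<lambda>n. if n = 0 then {} else \<Union>k\<in>K n. Bad n k)"
  have A_sets: "A n \<in> sets M" for n
    unfolding A_def using Bad_sets Kfin by (auto intro!: sets.finite_UN)
  have A_prob: "prob (A n) \<le> c / real n ^ 2" for n
  proof (cases "n = 0")
    case False
    then have n: "n \<ge> 1" by simp
    have "prob (\<Union>k\<in>K n. Bad n k) \<le> (\<Sum>k\<in>K n. prob (Bad n k))"
      using Bad_sets n by (intro finite_measure_subadditive_finite Kfin) auto
    also have "\<dots> \<le> real (card (K n)) * (c / real n ^ 3)"
      using Bad_prob[OF _ n] by (intro sum_bounded_above) auto
    also have "\<dots> \<le> real n * (c / real n ^ 3)"
      using Kcard[OF n] c by (intro mult_right_mono) auto
    also have "\<dots> = c / real n ^ 2"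
      using n by (simp add: power2_eq_square power3_eq_cube)
    finally show ?thesis using n by (simp add: A_def)
  qed (simp add: A_def)
  have "summable (\<lambda>n. c / real n ^ 2)"
    using summable_mult[OF inverse_power_summable[of 2, where 'a = real], of c] by (simp add: divide_inverse)
  then have "summable (\<lambda>n. prob (A n))"
    by (rule summable_comparison_test'[where N = 0]) (simp add: A_prob)
  then have "AE \<omega> in M. eventually (\<lambda>n. \<omega> \<in> space M - A n) sequentially"
    by (intro borel_cantelli_AE1 A_sets) (auto simp: emeasure_eq_measure)
  then show ?thesis
  proof eventually_elim
    case (elim \<omega>)
    then obtain N where N: "\<And>n. n \<ge> N \<Longrightarrow> \<omega> \<in> space M - A n"
      by (auto simp: eventually_sequentially)
    have "(SUP x\<in>{of_int k..of_int k + 1}. ennreal (f n k x \<omega>)) \<le> ennreal (b k)"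
      if n: "n \<ge> max N 1" and k: "k \<in> K n" for n k
    proof -
      have b: "b k > 0" using bpos[OF k] n by simp
      have "\<omega> \<in> space M" "\<omega> \<notin> Bad n k" using N[of n] n k by (auto simp: A_def split: if_splits)
      then have less: "ennreal (1 / b k ^ (2 * p)) * G n k \<omega> < 1" by (simp add: Bad_def not_le)
      have "f n k x \<omega> \<le> b k" if x: "x \<in> {of_int k..of_int k + 1}" for x
      proof -
        have "ennreal (1 / b k ^ (2 * p)) * ennreal (f n k x \<omega> ^ (2 * p)) \<le> ennreal (1 / b k ^ (2 * p)) * G n k \<omega>"
          unfolding G_def using x by (intro mult_left_mono SUP_upper) auto
        then have "ennreal (1 / b k ^ (2 * p) * f n k x \<omega> ^ (2 * p)) < 1"
          using less b by (subst ennreal_mult') auto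
        then have "1 / b k ^ (2 * p) * f n k x \<omega> ^ (2 * p) < 1"
          using b f by (simp add: ennreal_less_iff flip: ennreal_1)
        then have "f n k x \<omega> ^ (2 * p) < b k ^ (2 * p)" using b by (simp add: field_simps)
        then show ?thesis using b by (meson less_imp_le power_less_imp_less_base)
      qed
      then show ?thesis by (intro SUP_least ennreal_leI)
    qed
    then show ?case by (intro exI[of _ "max N 1"]) (auto simp: K_def b_def)
  qed
qed

theorem lemma12:
  fixes \<alpha> :: real
  assumes "0 < \<alpha>" and "\<alpha> < 1"
  shows
    "(\<forall>p::nat. p \<ge> 1 \<longrightarrow>
        (\<exists>C::real. \<forall>(M :: 'a measure) W \<delta> t k.
           std_planar_brownian_motion M W \<longrightarrow> 0 < \<delta> \<longrightarrow> \<delta> < \<alpha> \<longrightarrow> 0 < t \<longrightarrow>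
           k \<in> {\<delta> * t..\<alpha> * t} \<longrightarrow>
           expectation_le M
             (\<lambda>\<omega>. SUP x\<in>{k..k + 1}. ennreal
                (norm (conga \<alpha> (\<lambda>s. W s \<omega>) x t - conga \<alpha> (\<lambda>s. W s \<omega>) k t) ^ (2 * p)))
             (C * k powr (- (real p / 2))) \<and>
           expectation_le M
             (\<lambda>\<omega>. SUP x\<in>{k..k + 1}. ennreal
                (norm (conga_dx \<alpha> (\<lambda>s. W s \<omega>) x t - conga_dx \<alpha> (\<lambda>s. W s \<omega>) k t) ^ (2 * p)))
             (C * k powr (- (3 * real p / 2)))))
     \<and>
     (\<forall>(M :: 'a measure) W \<delta> \<eta> \<mu>.
        std_planar_brownian_motion M W \<longrightarrow> 0 < \<delta> \<longrightarrow> \<delta> < \<alpha> \<longrightarrow> 0 < \<eta> \<longrightarrow> 0 < \<mu> \<longrightarrow>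
        (AE \<omega> in M. \<exists>N::nat. N \<ge> 1 \<and> (\<forall>n::nat. n \<ge> N \<longrightarrow>
           (\<forall>k::int. of_int k \<in> {\<delta> * real n..\<alpha> * real n} \<longrightarrow>
              (SUP x\<in>{of_int k..of_int k + 1}. ennreal
                 (norm (conga \<alpha> (\<lambda>s. W s \<omega>) x (real n)
                        - conga \<alpha> (\<lambda>s. W s \<omega>) (of_int k) (real n))))
                \<le> ennreal (\<mu> * of_int k powr (- (1/4 - \<eta>))) \<and>
              (SUP x\<in>{of_int k..of_int k + 1}. ennreal
                 (norm (conga_dx \<alpha> (\<lambda>s. W s \<omega>) x (real n)
                        - conga_dx \<alpha> (\<lambda>s. W s \<omega>) (of_int k) (real n))))
                \<le> ennreal (\<mu> * of_int k powr (- (3/4 - \<eta>)))))))"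
    (is "?moments \<and> ?paths")
proof
  have \<sigma>: "conga_sigma \<alpha> > 0" using assms by (rule conga_sigma_pos)
  have bounds: "\<exists>C\<ge>0. \<forall>(M :: 'a measure) W t k. std_planar_brownian_motion M W \<longrightarrow> 0 < t \<longrightarrow> 0 < k \<longrightarrow>
           expectation_le M
             (\<lambda>\<omega>. SUP x\<in>{k..k + 1}. ennreal
                (norm (conga \<alpha> (\<lambda>s. W s \<omega>) x t - conga \<alpha> (\<lambda>s. W s \<omega>) k t) ^ (2 * p)))
             (C * k powr (- (real p / 2))) \<and>
           expectation_le M
             (\<lambda>\<omega>. SUP x\<in>{k..k + 1}. ennreal
                (norm (conga_dx \<alpha> (\<lambda>s. W s \<omega>) x t - conga_dx \<alpha> (\<lambda>s. W s \<omega>) k t) ^ (2 * p)))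
             (C * k powr (- (3 * real p / 2)))" if p: "p \<ge> 1" for p :: nat
  proof -
    define m where "m = planar_moment p"
    define C1 where "C1 = m * ((4 * (kappa \<alpha>)\<^sup>2) * conga_sigma \<alpha> * pi / sqrt \<alpha>) ^ p"
    define C2 where "C2 = m * (4 * (kappa \<alpha>)\<^sup>2 / (conga_sigma \<alpha>)\<^sup>2 * (4 * \<alpha> + 24 * (conga_sigma \<alpha>)\<^sup>2)
        * conga_sigma \<alpha> * pi / sqrt \<alpha>) ^ p * 9 ^ p"
    have "m \<ge> 0" unfolding m_def by (rule planar_moment_nonneg)
    then have C: "C1 \<ge> 0" "C2 \<ge> 0" using assms \<sigma> by (simp_all add: C1_def C2_def)
    show ?thesis
    proof (intro exI[of _ "C1 + C2"] conjI allI impI)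
      fix M :: "'a measure" and W and t k :: real
      assume W: "std_planar_brownian_motion M W" and t: "0 < t" and k: "0 < k"
      interpret std_planar_brownian_motion M W by (rule W)
      show "expectation_le M
             (\<lambda>\<omega>. SUP x\<in>{k..k + 1}. ennreal
                (norm (conga \<alpha> (\<lambda>s. W s \<omega>) x t - conga \<alpha> (\<lambda>s. W s \<omega>) k t) ^ (2 * p)))
             ((C1 + C2) * k powr (- (real p / 2)))"
        using C by (intro expectation_le_mono[OF conga_increment_moment[OF assms(1) \<sigma> t k p, folded m_def, folded C1_def]]
            mult_right_mono) auto
      show "expectation_le M
             (\<lambda>\<omega>. SUP x\<in>{k..k + 1}. ennreal
                (norm (conga_dx \<alpha> (\<lambda>s. W s \<omega>) x t - conga_dx \<alpha> (\<lambda>s. W s \<omega>) k t) ^ (2 * p)))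
             ((C1 + C2) * k powr (- (3 * real p / 2)))"
        using C by (intro expectation_le_mono[OF conga_dx_increment_moment[OF assms(1) \<sigma> t k p, folded m_def, folded C2_def]]
            mult_right_mono) auto
    qed (use C in auto)
  qed
  have kpos: "k > 0" if "0 < \<delta>" "0 < t" "k \<in> {\<delta> * t..\<alpha> * t}" for \<delta> t k :: real
    using mult_pos_pos[OF that(1,2)] that(3) by (auto intro: less_le_trans simp del: zero_less_mult_iff)
  show ?moments
    using bounds kpos by meson
  show ?paths
  proof (intro allI impI)
    fix M :: "'a measure" and W and \<delta> \<eta> \<mu> :: real
    assume W: "std_planar_brownian_motion M W" and \<delta>: "0 < \<delta>" "\<delta> < \<alpha>" and \<eta>: "0 < \<eta>" and \<mu>: "0 < \<mu>"
    interpret std_planar_brownian_motion M W by (rule W)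
    \<comment> \<open>the moment order is chosen large enough for a summable bound \<open>n * n\<^sup>-\<^sup>3\<close>\<close>
    obtain p :: nat where "3 / (2 * \<eta>) < real p" using reals_Archimedean2 by blast
    then have p: "3 \<le> 2 * real p * \<eta>" using \<eta> by (simp add: field_simps)
    then have p1: "p \<ge> 1" by (cases p) auto
    obtain C where C: "C \<ge> 0" and moment: "\<And>t k. 0 < t \<Longrightarrow> 0 < k \<Longrightarrow>
           expectation_le M
             (\<lambda>\<omega>. SUP x\<in>{k..k + 1}. ennreal
                (norm (conga \<alpha> (\<lambda>s. W s \<omega>) x t - conga \<alpha> (\<lambda>s. W s \<omega>) k t) ^ (2 * p)))
             (C * k powr (- (real p / 2))) \<and>
           expectation_le M
             (\<lambda>\<omega>. SUP x\<in>{k..k + 1}. ennreal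
                (norm (conga_dx \<alpha> (\<lambda>s. W s \<omega>) x t - conga_dx \<alpha> (\<lambda>s. W s \<omega>) k t) ^ (2 * p)))
             (C * k powr (- (3 * real p / 2)))"
      using bounds[OF p1] W by blast
    have e: "1/4 * (2 * real p) = real p / 2" "3/4 * (2 * real p) = 3 * real p / 2" by auto
    have "AE \<omega> in M. \<exists>N::nat. N \<ge> 1 \<and> (\<forall>n::nat. n \<ge> N \<longrightarrow>
           (\<forall>k::int. of_int k \<in> {\<delta> * real n..\<alpha> * real n} \<longrightarrow>
              (SUP x\<in>{of_int k..of_int k + 1}. ennreal
                 (norm (conga \<alpha> (\<lambda>s. W s \<omega>) x (real n) - conga \<alpha> (\<lambda>s. W s \<omega>) (of_int k) (real n))))
                \<le> ennreal (\<mu> * of_int k powr (- (1/4 - \<eta>)))))"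
    proof (rule AE_eventually_sup_le[OF \<delta>(1) assms(2) \<mu> C p])
      fix n :: nat and k :: int
      assume n: "1 \<le> n" and k: "of_int k \<in> {\<delta> * real n..\<alpha> * real n}"
      have n0: "0 < real n" using n by simp
      show "expectation_le M
          (\<lambda>\<omega>. SUP x\<in>{of_int k..of_int k + 1}. ennreal
             (norm (conga \<alpha> (\<lambda>s. W s \<omega>) x (real n) - conga \<alpha> (\<lambda>s. W s \<omega>) (of_int k) (real n)) ^ (2 * p)))
          (C * of_int k powr (- (1/4 * (2 * real p))))"
        unfolding e by (rule conjunct1[OF moment[OF n0 kpos[OF \<delta>(1) n0 k]]])
    qed (rule norm_ge_zero)
    moreover have "AE \<omega> in M. \<exists>N::nat. N \<ge> 1 \<and> (\<forall>n::nat. n \<ge> N \<longrightarrow>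
           (\<forall>k::int. of_int k \<in> {\<delta> * real n..\<alpha> * real n} \<longrightarrow>
              (SUP x\<in>{of_int k..of_int k + 1}. ennreal
                 (norm (conga_dx \<alpha> (\<lambda>s. W s \<omega>) x (real n) - conga_dx \<alpha> (\<lambda>s. W s \<omega>) (of_int k) (real n))))
                \<le> ennreal (\<mu> * of_int k powr (- (3/4 - \<eta>)))))"
    proof (rule AE_eventually_sup_le[OF \<delta>(1) assms(2) \<mu> C p])
      fix n :: nat and k :: int
      assume n: "1 \<le> n" and k: "of_int k \<in> {\<delta> * real n..\<alpha> * real n}"
      have n0: "0 < real n" using n by simp
      show "expectation_le M
          (\<lambda>\<omega>. SUP x\<in>{of_int k..of_int k + 1}. ennreal
             (norm (conga_dx \<alpha> (\<lambda>s. W s \<omega>) x (real n) - conga_dx \<alpha> (\<lambda>s. W s \<omega>) (of_int k) (real n)) ^ (2 * p)))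
          (C * of_int k powr (- (3/4 * (2 * real p))))"
        unfolding e by (rule conjunct2[OF moment[OF n0 kpos[OF \<delta>(1) n0 k]]])
    qed (rule norm_ge_zero)
    ultimately show "AE \<omega> in M. \<exists>N::nat. N \<ge> 1 \<and> (\<forall>n::nat. n \<ge> N \<longrightarrow>
           (\<forall>k::int. of_int k \<in> {\<delta> * real n..\<alpha> * real n} \<longrightarrow>
              (SUP x\<in>{of_int k..of_int k + 1}. ennreal
                 (norm (conga \<alpha> (\<lambda>s. W s \<omega>) x (real n) - conga \<alpha> (\<lambda>s. W s \<omega>) (of_int k) (real n))))
                \<le> ennreal (\<mu> * of_int k powr (- (1/4 - \<eta>))) \<and>
              (SUP x\<in>{of_int k..of_int k + 1}. ennreal
                 (norm (conga_dx \<alpha> (\<lambda>s. W s \<omega>) x (real n) - conga_dx \<alpha> (\<lambda>s. W s \<omega>) (of_int k) (real n))))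
                \<le> ennreal (\<mu> * of_int k powr (- (3/4 - \<eta>)))))"
    proof eventually_elim
      case (elim \<omega>)
      then obtain N1 N2 where "N1 \<ge> 1" "N2 \<ge> 1"
        and *: "\<forall>n\<ge>N1. \<forall>k::int. of_int k \<in> {\<delta> * real n..\<alpha> * real n} \<longrightarrow>
              (SUP x\<in>{of_int k..of_int k + 1}. ennreal
                 (norm (conga \<alpha> (\<lambda>s. W s \<omega>) x (real n) - conga \<alpha> (\<lambda>s. W s \<omega>) (of_int k) (real n))))
                \<le> ennreal (\<mu> * of_int k powr (- (1/4 - \<eta>)))"
          "\<forall>n\<ge>N2. \<forall>k::int. of_int k \<in> {\<delta> * real n..\<alpha> * real n} \<longrightarrow>
              (SUP x\<in>{of_int k..of_int k + 1}. ennreal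
                 (norm (conga_dx \<alpha> (\<lambda>s. W s \<omega>) x (real n) - conga_dx \<alpha> (\<lambda>s. W s \<omega>) (of_int k) (real n))))
                \<le> ennreal (\<mu> * of_int k powr (- (3/4 - \<eta>)))"
        by blast
      show ?case
        using \<open>N1 \<ge> 1\<close> * by (intro exI[of _ "max N1 N2"]) (simp add: max.coboundedI1)
    qed
  qed
qed

end
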